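(* Let $\mathbf K$ be as in the context and let $\downarrow$ be a simple independence relation in $\mathbf K$ with the $(<\aleph_0)$-witness property for singletons. If $\mu,\lambda$ are cardinals with $\operatorname{LS}(\mathbf K)\le\mu\le\lambda$, $\kappa(\downarrow)\le\mu$ and $\mu^{<\ell(\downarrow)}=\mu$, then \[ NT(\mu,\lambda,(2^\mu)^+)\le\lambda^{\kappa(\downarrow)}+2^\mu. \]
   Context: $\mathbf{K}$ is an abstract elementary class (AEC) with strong substructure relation $\le_{\mathbf K}$ and Löwenheim–Skolem–Tarski number $\operatorname{LS}(\mathbf K)$, with joint embedding, amalgamation and no maximal models; we work in a monster model $\mathfrak C$. Galois-types $\mathbf{tp}(\mathbf b/A)$ are orbits of $\mathbf b$ under automorphisms of $\mathfrak C$ fixing $A$ pointwise; $\mathbf S^\alpha(M)$, $\mathbf S^\alpha(A)$ are the sets of Galois-types of length $\alpha$ over $M$, $A$; $\mathbf S(M)=\mathbf S^1(M)$, $\mathbf S^{<\infty}=\bigcup_\alpha\mathbf S^\alpha$. $\mathbf K_\lambda$ is the class of models of size $\lambda$. A set of Galois-types is consistent if a single $a\in\mathfrak C$ realizes all of them, otherwise inconsistent. An independence relation is a relation $A\downarrow_M B$ ($M\le_{\mathbf K}\mathfrak C$, $A,B\subseteq\mathfrak C$) satisfying: invariance under automorphisms of $\mathfrak C$; monotonicity; normality ($A\downarrow_MB$ iff $A\cup M\downarrow_MB\cup M$); base monotonicity (if $A\downarrow_MB$, $M\le_{\mathbf K}N$, $|N|\subseteq B$ then $A\downarrow_NB$);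 existence (every $p\in\mathbf S^{<\infty}(M)$ has, for each $N\ge_{\mathbf K}M$, an extension in $\mathbf S^{<\infty}(N)$ not forking over $M$); transitivity (if $M\le_{\mathbf K}N$, $A\downarrow_MN$, $A\downarrow_NB$ then $A\downarrow_MB$). "$\mathbf{tp}(\bar a/B)$ does not fork over $M$" means $\mathrm{ran}(\bar a)\downarrow_MB$. A simple independence relation additionally satisfies symmetry ($A\downarrow_MB$ iff $B\downarrow_MA$); type-amalgamation (if $p\in\mathbf S^{<\infty}(M)$, $M\subseteq A,B$, $A\downarrow_MB$, $N^*\in\mathbf K$ contains $A\cup B$, and $q_1\in\mathbf S^{<\infty}(A)$, $q_2\in\mathbf S^{<\infty}(B)$ both extend $p$ and do not fork over $M$, then some $q\in\mathbf S^{<\infty}(N^* )$ extends $q_1,q_2$ and does not fork over $M$); uniform local character (there are cardinals $\lambda,\theta$ such that every $p\in\mathbf S^\alpha(M)$ does not fork over some $M_0\le_{\mathbf K}M$ with $\|M_0\|\le\lambda+\alpha^{<\theta}$); $(\kappa(\downarrow),\ell(\downarrow))$ is the lexicographically least such pair $(\lambda,\theta)$. $\downarrow$ has the $(<\aleph_0)$-witness property for singletons if for all $M\le_{\mathbf K}N$ and $b\in\mathfrak C$: $b\downarrow_MN$ iff $b\downarrow_MA$ for every finite $A\subseteq N$. For $M\in\mathbf K$ and $\mu\le\|M\|$, $\mathbf S(M,\le\mu)=\{\mathbf{tp}(a/N):a\in\mathfrak C,\ N\le_{\mathbf K}M,\ \|N\|\le\mu\}$. For $\operatorname{LS}(\mathbf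 K)\le\mu\le\lambda$ and a cardinal $\kappa$, $NT(\mu,\lambda,\kappa)$ is the supremum of $|\Gamma|$ over all $\Gamma$ for which there is $M\in\mathbf K_\lambda$ with $\Gamma\subseteq\mathbf S(M,\le\mu)$ and every $\Delta\subseteq\Gamma$ with $|\Delta|\ge\kappa$ inconsistent.
   Formalization: The pair (κ(↓),ℓ(↓)) is taken lexicographically least among pairs with κ ≥ 1: if κ = 0 is allowed the bound fails, e.g. for nonempty pure sets with A∩B⊆M as independence and λ > 2^μ. As usual, λ is assumed below the (strong limit) size bound of the monster model. *)

theory Defs
  imports Main "HOL-Library.FuncSet"
begin

unbundle cardinal_syntax

definition is_card_sup :: "'b rel set \<Rightarrow> 'b rel \<Rightarrow> bool" where
  "is_card_sup R s \<longleftrightarrow> Card_order s \<and> (\<forall>r\<in>R. r \<le>o s) \<and>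
     (\<forall>t :: 'b rel. Card_order t \<and> (\<forall>r\<in>R. r \<le>o t) \<longrightarrow> s \<le>o t)"

definition card_sup :: "'b rel set \<Rightarrow> 'b rel" where
  "card_sup R = (SOME s. is_card_sup R s)"

lemma is_card_sup_card_sup:
  fixes R :: "'b rel set"
  assumes "\<And>r. r \<in> R \<Longrightarrow> Card_order r"
  shows "is_card_sup R (card_sup R)"
proof -
  let ?U = "{s :: 'b rel. Card_order s \<and> (\<forall>r\<in>R. r \<le>o s)}"
  have "r \<le>o |UNIV :: 'b set|" if "r \<in> R" for r
    using assms[OF that] card_of_Field_ordIso card_of_mono1 ordIso_ordLeq_trans ordIso_symmetric
    by (metis subset_UNIV)
  then have "|UNIV :: 'b set| \<in> ?U" by (simp add: card_of_Card_order)
  then have "?U \<noteq> {}" by blast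
  moreover have "\<forall>s\<in>?U. Card_order s" by simp
  ultimately obtain s where "s \<in> ?U" "\<forall>t\<in>?U. s \<le>o t"
    using exists_minim_Card_order[of ?U] by meson
  then have "is_card_sup R s" unfolding is_card_sup_def by simp
  then show ?thesis unfolding card_sup_def by (rule someI)
qed

text \<open>\<open>r\<close> to the power \<open>< t\<close>, that is, the supremum of \<open>r ^c s\<close> over the cardinals \<open>s <o t\<close>
  (so \<open>1\<close> to the power \<open>< t\<close> is \<open>1\<close> for \<open>t \<noteq> 0\<close>).\<close>

definition cexp_less :: "'b rel \<Rightarrow> 'a rel \<Rightarrow> ('a \<Rightarrow> 'b) rel" where
  "cexp_less r t = card_sup {r ^c s | s :: 'a rel. Card_order s \<and> s <o t}"

definition strong_limit :: "'a rel \<Rightarrow> bool" where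
  "strong_limit k \<longleftrightarrow> Card_order k \<and> cinfinite k \<and>
     (\<forall>s :: 'a rel. Card_order s \<and> s <o k \<longrightarrow> ctwo ^c s <o k)"

record ('f, 'r) language =
  funs :: "'f set"
  rels :: "'r set"
  fun_ar :: "'f \<Rightarrow> nat"
  rel_ar :: "'r \<Rightarrow> nat"

record ('f, 'r, 'a) struct =
  univ :: "'a set"
  fint :: "'f \<Rightarrow> 'a list \<Rightarrow> 'a"
  rint :: "'r \<Rightarrow> 'a list \<Rightarrow> bool"

definition tuples :: "'a set \<Rightarrow> nat \<Rightarrow> 'a list set" where
  "tuples A n = {xs. set xs \<subseteq> A \<and> length xs = n}"

text \<open>The interpretations carry no information outside the universe and the language, so that
  equality of structures in HOL is equality of structures.\<close>

definition is_struct :: "('f, 'r) language \<Rightarrow> ('f, 'r, 'a) struct \<Rightarrow> bool" where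
  "is_struct L M \<longleftrightarrow> univ M \<noteq> {} \<and>
     (\<forall>f xs. if f \<in> funs L \<and> xs \<in> tuples (univ M) (fun_ar L f)
             then fint M f xs \<in> univ M else fint M f xs = undefined) \<and>
     (\<forall>R xs. rint M R xs \<longrightarrow> R \<in> rels L \<and> xs \<in> tuples (univ M) (rel_ar L R))"

definition substruct ::
  "('f, 'r) language \<Rightarrow> ('f, 'r, 'a) struct \<Rightarrow> ('f, 'r, 'a) struct \<Rightarrow> bool" where
  "substruct L M N \<longleftrightarrow> is_struct L M \<and> is_struct L N \<and> univ M \<subseteq> univ N \<and>
     (\<forall>f\<in>funs L. \<forall>xs\<in>tuples (univ M) (fun_ar L f). fint M f xs = fint N f xs) \<and>
     (\<forall>R\<in>rels L. \<forall>xs\<in>tuples (univ M) (rel_ar L R). rint M R xs \<longleftrightarrow> rint N R xs)"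

definition is_iso ::
  "('f, 'r) language \<Rightarrow> ('a \<Rightarrow> 'a) \<Rightarrow> ('f, 'r, 'a) struct \<Rightarrow> ('f, 'r, 'a) struct \<Rightarrow> bool" where
  "is_iso L h M N \<longleftrightarrow> is_struct L M \<and> is_struct L N \<and> bij_betw h (univ M) (univ N) \<and>
     (\<forall>f\<in>funs L. \<forall>xs\<in>tuples (univ M) (fun_ar L f). h (fint M f xs) = fint N f (map h xs)) \<and>
     (\<forall>R\<in>rels L. \<forall>xs\<in>tuples (univ M) (rel_ar L R). rint M R xs \<longleftrightarrow> rint N R (map h xs))"

text \<open>All structures have their universe inside the type \<open>'a\<close>; a class of structures is thus
  represented by its members of size at most the size of \<open>'a\<close>, where \<open>'a\<close> is arbitrary.\<close>

record ('f, 'r, 'a) aec =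
  lang :: "('f, 'r) language"
  mods :: "('f, 'r, 'a) struct set"
  leK :: "('f, 'r, 'a) struct \<Rightarrow> ('f, 'r, 'a) struct \<Rightarrow> bool"

definition LST_bound :: "('f, 'r, 'a) aec \<Rightarrow> 'a rel \<Rightarrow> bool" where
  "LST_bound K r \<longleftrightarrow> Card_order r \<and> cinfinite r \<and>
     |funs (lang K)| +c |rels (lang K)| \<le>o r \<and>
     (\<forall>M\<in>mods K. \<forall>A. A \<subseteq> univ M \<longrightarrow>
        (\<exists>N. leK K N M \<and> A \<subseteq> univ N \<and> |univ N| \<le>o |A| +c r))"

definition is_LS :: "('f, 'r, 'a) aec \<Rightarrow> 'a rel \<Rightarrow> bool" where
  "is_LS K r \<longleftrightarrow> LST_bound K r \<and> (\<forall>s. LST_bound K s \<longrightarrow> r \<le>o s)"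

text \<open>In the two chain axioms \<open>U\<close> is the union of the chain \<open>\<C>\<close>: the only structure on
  the union of the universes that has every member of \<open>\<C>\<close> as a substructure. The increasing
  sequences indexed by ordinals are represented by their ranges.\<close>

definition chain_union ::
  "('f, 'r, 'a) aec \<Rightarrow> ('f, 'r, 'a) struct set \<Rightarrow> ('f, 'r, 'a) struct \<Rightarrow> bool" where
  "chain_union K \<C> U \<longleftrightarrow>
     \<C> \<noteq> {} \<and> \<C> \<subseteq> mods K \<and> well_order_on \<C> {(M, N). M \<in> \<C> \<and> N \<in> \<C> \<and> leK K M N} \<and>
     is_struct (lang K) U \<and> univ U = (\<Union>M\<in>\<C>. univ M) \<and> (\<forall>M\<in>\<C>. substruct (lang K) M U)"

definition AEC :: "('f, 'r, 'a) aec \<Rightarrow> bool" where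
  "AEC K \<longleftrightarrow>
     (\<forall>M\<in>mods K. is_struct (lang K) M) \<and>
     (\<forall>M N. leK K M N \<longrightarrow> M \<in> mods K \<and> N \<in> mods K \<and> substruct (lang K) M N) \<and>
     (\<forall>M\<in>mods K. leK K M M) \<and>
     (\<forall>M N P. leK K M N \<and> leK K N P \<longrightarrow> leK K M P) \<and>
     (\<forall>M N h. M \<in> mods K \<and> is_iso (lang K) h M N \<longrightarrow> N \<in> mods K) \<and>
     (\<forall>M N M' N' h. leK K M N \<and> is_iso (lang K) h N N' \<and> is_iso (lang K) h M M'
        \<longrightarrow> leK K M' N') \<and>
     (\<forall>M N P. leK K M P \<and> leK K N P \<and> substruct (lang K) M N \<longrightarrow> leK K M N) \<and>
     (\<forall>\<C> U. chain_union K \<C> U \<longrightarrow> U \<in> mods K \<and> (\<forall>M\<in>\<C>. leK K M U)) \<and>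
     (\<forall>\<C> U N. chain_union K \<C> U \<and> (\<forall>M\<in>\<C>. leK K M N) \<longrightarrow> leK K U N) \<and>
     (\<exists>r. LST_bound K r)"

definition K_embedding ::
  "('f, 'r, 'a) aec \<Rightarrow> ('a \<Rightarrow> 'a) \<Rightarrow> ('f, 'r, 'a) struct \<Rightarrow> ('f, 'r, 'a) struct \<Rightarrow> bool" where
  "K_embedding K h M N \<longleftrightarrow> (\<exists>N'. leK K N' N \<and> is_iso (lang K) h M N')"

definition joint_embedding :: "('f, 'r, 'a) aec \<Rightarrow> bool" where
  "joint_embedding K \<longleftrightarrow> (\<forall>M\<^sub>1\<in>mods K. \<forall>M\<^sub>2\<in>mods K. \<exists>N\<in>mods K. \<exists>h\<^sub>1 h\<^sub>2.
     K_embedding K h\<^sub>1 M\<^sub>1 N \<and> K_embedding K h\<^sub>2 M\<^sub>2 N)"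

definition amalgamation :: "('f, 'r, 'a) aec \<Rightarrow> bool" where
  "amalgamation K \<longleftrightarrow> (\<forall>M\<^sub>0 M\<^sub>1 M\<^sub>2. leK K M\<^sub>0 M\<^sub>1 \<and> leK K M\<^sub>0 M\<^sub>2 \<longrightarrow>
     (\<exists>N\<in>mods K. \<exists>h\<^sub>1 h\<^sub>2. K_embedding K h\<^sub>1 M\<^sub>1 N \<and> K_embedding K h\<^sub>2 M\<^sub>2 N \<and>
        (\<forall>x\<in>univ M\<^sub>0. h\<^sub>1 x = h\<^sub>2 x)))"

text \<open>The proper extension is taken up to isomorphism: a model whose universe is all of \<open>'a\<close>
  leaves no room for new elements.\<close>

definition no_maximal_models :: "('f, 'r, 'a) aec \<Rightarrow> bool" where
  "no_maximal_models K \<longleftrightarrow> (\<forall>M\<in>mods K. \<exists>N\<in>mods K. \<exists>h.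
     K_embedding K h M N \<and> h ` univ M \<noteq> univ N)"

text \<open>As usual, ``small'' means of size less than \<open>kbar\<close>, for a strong limit \<open>kbar\<close> above all cardinals
  under consideration. The monster model need not have size \<open>kbar\<close>.\<close>

definition monster :: "('f, 'r, 'a) aec \<Rightarrow> 'a rel \<Rightarrow> ('f, 'r, 'a) struct \<Rightarrow> bool" where
  "monster K kbar C \<longleftrightarrow> strong_limit kbar \<and> C \<in> mods K \<and>
     (\<forall>M\<in>mods K. |univ M| <o kbar \<longrightarrow> (\<exists>h. K_embedding K h M C)) \<and>
     (\<forall>M N h. leK K M C \<and> leK K N C \<and> |univ M| <o kbar \<and> is_iso (lang K) h M N \<longrightarrow>
        (\<exists>g. is_iso (lang K) g C C \<and> (\<forall>x\<in>univ M. g x = h x)))"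

definition small_model ::
  "('f, 'r, 'a) aec \<Rightarrow> 'a rel \<Rightarrow> ('f, 'r, 'a) struct \<Rightarrow> ('f, 'r, 'a) struct \<Rightarrow> bool" where
  "small_model K kbar C M \<longleftrightarrow> leK K M C \<and> |univ M| <o kbar"

definition small_set :: "'a rel \<Rightarrow> ('f, 'r, 'a) struct \<Rightarrow> 'a set \<Rightarrow> bool" where
  "small_set kbar C A \<longleftrightarrow> A \<subseteq> univ C \<and> |A| <o kbar"

text \<open>A type consists of its domain and an orbit of sequences. A sequence of length \<open>\<alpha>\<close>, for a
  well-order \<open>\<alpha>\<close>, is a function on \<open>Field \<alpha>\<close>.\<close>

type_synonym ('i, 'a) gtype = "'a set \<times> ('i \<Rightarrow> 'a) set"

definition gtp ::
  "('f, 'r, 'a) aec \<Rightarrow> ('f, 'r, 'a) struct \<Rightarrow> 'i set \<Rightarrow> ('i \<Rightarrow> 'a) \<Rightarrow> 'a set \<Rightarrow> ('i, 'a) gtype" where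
  "gtp K C I b A =
     (A, {restrict (g \<circ> b) I | g. is_iso (lang K) g C C \<and> (\<forall>a\<in>A. g a = a)})"

definition gS ::
  "('f, 'r, 'a) aec \<Rightarrow> ('f, 'r, 'a) struct \<Rightarrow> 'i rel \<Rightarrow> 'a set \<Rightarrow> ('i, 'a) gtype set" where
  "gS K C \<alpha> A = {gtp K C (Field \<alpha>) b A | b. b \<in> Field \<alpha> \<rightarrow> univ C}"

definition extends :: "('i, 'a) gtype \<Rightarrow> ('i, 'a) gtype \<Rightarrow> bool" where
  "extends q p \<longleftrightarrow> fst p \<subseteq> fst q \<and> snd q \<subseteq> snd p"

definition small_length :: "'a rel \<Rightarrow> 'a rel \<Rightarrow> bool" where
  "small_length kbar \<alpha> \<longleftrightarrow> Well_order \<alpha> \<and> |Field \<alpha>| <o kbar"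

text \<open>Types of elements are types of sequences of length 1, indexed by the type \<open>unit\<close>.\<close>

definition tp1 ::
  "('f, 'r, 'a) aec \<Rightarrow> ('f, 'r, 'a) struct \<Rightarrow> 'a \<Rightarrow> 'a set \<Rightarrow> (unit, 'a) gtype" where
  "tp1 K C a A = gtp K C UNIV (\<lambda>_. a) A"

definition realizes ::
  "('f, 'r, 'a) aec \<Rightarrow> ('f, 'r, 'a) struct \<Rightarrow> 'a \<Rightarrow> (unit, 'a) gtype \<Rightarrow> bool" where
  "realizes K C a p \<longleftrightarrow> p = tp1 K C a (fst p)"

definition consistent ::
  "('f, 'r, 'a) aec \<Rightarrow> ('f, 'r, 'a) struct \<Rightarrow> (unit, 'a) gtype set \<Rightarrow> bool" where
  "consistent K C \<Delta> \<longleftrightarrow> (\<exists>a\<in>univ C. \<forall>p\<in>\<Delta>. realizes K C a p)"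

text \<open>\<open>ind A M B\<close> stands for: \<open>A\<close> is independent from \<open>B\<close> over \<open>M\<close>.\<close>

type_synonym ('f, 'r, 'a) indrel = "'a set \<Rightarrow> ('f, 'r, 'a) struct \<Rightarrow> 'a set \<Rightarrow> bool"

definition does_not_fork ::
  "('f, 'r, 'a) aec \<Rightarrow> ('f, 'r, 'a) struct \<Rightarrow> ('f, 'r, 'a) indrel \<Rightarrow> 'i rel \<Rightarrow>
   ('i, 'a) gtype \<Rightarrow> ('f, 'r, 'a) struct \<Rightarrow> bool" where
  "does_not_fork K C ind \<alpha> p M \<longleftrightarrow>
     (\<exists>b \<in> Field \<alpha> \<rightarrow> univ C. p = gtp K C (Field \<alpha>) b (fst p) \<and> ind (b ` Field \<alpha>) M (fst p))"

definition ind_invariance ::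
  "('f, 'r, 'a) aec \<Rightarrow> 'a rel \<Rightarrow> ('f, 'r, 'a) struct \<Rightarrow> ('f, 'r, 'a) indrel \<Rightarrow> bool" where
  "ind_invariance K kbar C ind \<longleftrightarrow> (\<forall>g A M N B.
     is_iso (lang K) g C C \<and> small_model K kbar C M \<and> small_model K kbar C N \<and> is_iso (lang K) g M N \<and>
     small_set kbar C A \<and> small_set kbar C B \<and> ind A M B \<longrightarrow> ind (g ` A) N (g ` B))"

definition ind_monotonicity ::
  "('f, 'r, 'a) aec \<Rightarrow> 'a rel \<Rightarrow> ('f, 'r, 'a) struct \<Rightarrow> ('f, 'r, 'a) indrel \<Rightarrow> bool" where
  "ind_monotonicity K kbar C ind \<longleftrightarrow> (\<forall>A M B A' B'.
     small_model K kbar C M \<and> small_set kbar C A \<and> small_set kbar C B \<and>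
     ind A M B \<and> A' \<subseteq> A \<and> B' \<subseteq> B \<longrightarrow> ind A' M B')"

definition ind_normality ::
  "('f, 'r, 'a) aec \<Rightarrow> 'a rel \<Rightarrow> ('f, 'r, 'a) struct \<Rightarrow> ('f, 'r, 'a) indrel \<Rightarrow> bool" where
  "ind_normality K kbar C ind \<longleftrightarrow> (\<forall>A M B.
     small_model K kbar C M \<and> small_set kbar C A \<and> small_set kbar C B \<longrightarrow>
     (ind A M B \<longleftrightarrow> ind (A \<union> univ M) M (B \<union> univ M)))"

definition ind_base_monotonicity ::
  "('f, 'r, 'a) aec \<Rightarrow> 'a rel \<Rightarrow> ('f, 'r, 'a) struct \<Rightarrow> ('f, 'r, 'a) indrel \<Rightarrow> bool" where
  "ind_base_monotonicity K kbar C ind \<longleftrightarrow> (\<forall>A M N B.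
     small_model K kbar C M \<and> small_model K kbar C N \<and> small_set kbar C A \<and> small_set kbar C B \<and>
     ind A M B \<and> leK K M N \<and> univ N \<subseteq> B \<longrightarrow> ind A N B)"

definition ind_existence ::
  "('f, 'r, 'a) aec \<Rightarrow> 'a rel \<Rightarrow> ('f, 'r, 'a) struct \<Rightarrow> ('f, 'r, 'a) indrel \<Rightarrow> bool" where
  "ind_existence K kbar C ind \<longleftrightarrow> (\<forall>(\<alpha> :: 'a rel) M N. \<forall>p\<in>gS K C \<alpha> (univ M).
     small_length kbar \<alpha> \<and> small_model K kbar C M \<and> small_model K kbar C N \<and> leK K M N \<longrightarrow>
     (\<exists>q\<in>gS K C \<alpha> (univ N). extends q p \<and> does_not_fork K C ind \<alpha> q M))"

definition ind_transitivity ::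
  "('f, 'r, 'a) aec \<Rightarrow> 'a rel \<Rightarrow> ('f, 'r, 'a) struct \<Rightarrow> ('f, 'r, 'a) indrel \<Rightarrow> bool" where
  "ind_transitivity K kbar C ind \<longleftrightarrow> (\<forall>A M N B.
     small_model K kbar C M \<and> small_model K kbar C N \<and> small_set kbar C A \<and> small_set kbar C B \<and>
     leK K M N \<and> ind A M (univ N) \<and> ind A N B \<longrightarrow> ind A M B)"

definition independence_relation ::
  "('f, 'r, 'a) aec \<Rightarrow> 'a rel \<Rightarrow> ('f, 'r, 'a) struct \<Rightarrow> ('f, 'r, 'a) indrel \<Rightarrow> bool" where
  "independence_relation K kbar C ind \<longleftrightarrow>
     ind_invariance K kbar C ind \<and> ind_monotonicity K kbar C ind \<and> ind_normality K kbar C ind \<and>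
     ind_base_monotonicity K kbar C ind \<and> ind_existence K kbar C ind \<and> ind_transitivity K kbar C ind"

definition ind_symmetry ::
  "('f, 'r, 'a) aec \<Rightarrow> 'a rel \<Rightarrow> ('f, 'r, 'a) struct \<Rightarrow> ('f, 'r, 'a) indrel \<Rightarrow> bool" where
  "ind_symmetry K kbar C ind \<longleftrightarrow> (\<forall>A M B.
     small_model K kbar C M \<and> small_set kbar C A \<and> small_set kbar C B \<longrightarrow> (ind A M B \<longleftrightarrow> ind B M A))"

definition type_amalgamation ::
  "('f, 'r, 'a) aec \<Rightarrow> 'a rel \<Rightarrow> ('f, 'r, 'a) struct \<Rightarrow> ('f, 'r, 'a) indrel \<Rightarrow> bool" where
  "type_amalgamation K kbar C ind \<longleftrightarrow>
     (\<forall>(\<alpha> :: 'a rel) M A B N. \<forall>p\<in>gS K C \<alpha> (univ M). \<forall>q\<^sub>1\<in>gS K C \<alpha> A. \<forall>q\<^sub>2\<in>gS K C \<alpha> B.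
        small_length kbar \<alpha> \<and> small_model K kbar C M \<and> small_set kbar C A \<and> small_set kbar C B \<and>
        univ M \<subseteq> A \<and> univ M \<subseteq> B \<and> ind A M B \<and>
        small_model K kbar C N \<and> A \<union> B \<subseteq> univ N \<and>
        extends q\<^sub>1 p \<and> extends q\<^sub>2 p \<and>
        does_not_fork K C ind \<alpha> q\<^sub>1 M \<and> does_not_fork K C ind \<alpha> q\<^sub>2 M \<longrightarrow>
        (\<exists>q\<in>gS K C \<alpha> (univ N). extends q q\<^sub>1 \<and> extends q q\<^sub>2 \<and> does_not_fork K C ind \<alpha> q M))"

definition local_character_pair ::
  "('f, 'r, 'a) aec \<Rightarrow> 'a rel \<Rightarrow> ('f, 'r, 'a) struct \<Rightarrow> ('f, 'r, 'a) indrel \<Rightarrow>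
   'a rel \<Rightarrow> 'a rel \<Rightarrow> bool" where
  "local_character_pair K kbar C ind lam \<theta> \<longleftrightarrow>
     Card_order lam \<and> lam <o kbar \<and> Card_order \<theta> \<and> \<theta> <o kbar \<and>
     (\<forall>(\<alpha> :: 'a rel) M. \<forall>p\<in>gS K C \<alpha> (univ M).
        small_length kbar \<alpha> \<and> small_model K kbar C M \<longrightarrow>
        (\<exists>M\<^sub>0. leK K M\<^sub>0 M \<and> |univ M\<^sub>0| \<le>o lam +c cexp_less |Field \<alpha>| \<theta> \<and>
           does_not_fork K C ind \<alpha> p M\<^sub>0))"

definition simple_independence_relation ::
  "('f, 'r, 'a) aec \<Rightarrow> 'a rel \<Rightarrow> ('f, 'r, 'a) struct \<Rightarrow> ('f, 'r, 'a) indrel \<Rightarrow> bool" where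
  "simple_independence_relation K kbar C ind \<longleftrightarrow>
     independence_relation K kbar C ind \<and> ind_symmetry K kbar C ind \<and> type_amalgamation K kbar C ind \<and>
     (\<exists>lam \<theta>. local_character_pair K kbar C ind lam \<theta>)"

text \<open>The lexicographically least pair, among those whose first component is nonzero. The
  restriction matters because 1 to the power \<open>< \<theta>\<close> is 1: for pure sets, with \<open>A \<inter> B \<subseteq> M\<close> as
  independence, the pair \<open>(0, 2)\<close> has the local character property, although the types of \<open>a\<close>
  over \<open>{a}\<close>, for \<open>a\<close> in a model of size \<open>lam\<close>, are \<open>lam\<close> pairwise inconsistent types, more than
  \<open>lam ^c 0 +c ctwo ^c \<mu>\<close> when \<open>ctwo ^c \<mu> <o lam\<close>.\<close>

definition is_kappa_ell ::
  "('f, 'r, 'a) aec \<Rightarrow> 'a rel \<Rightarrow> ('f, 'r, 'a) struct \<Rightarrow> ('f, 'r, 'a) indrel \<Rightarrow>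
   'a rel \<Rightarrow> 'a rel \<Rightarrow> bool" where
  "is_kappa_ell K kbar C ind kap ell \<longleftrightarrow>
     local_character_pair K kbar C ind kap ell \<and> Field kap \<noteq> {} \<and>
     (\<forall>lam \<theta>. local_character_pair K kbar C ind lam \<theta> \<and> Field lam \<noteq> {} \<longrightarrow>
        kap <o lam \<or> (kap =o lam \<and> ell \<le>o \<theta>))"

definition finite_witness_singletons ::
  "('f, 'r, 'a) aec \<Rightarrow> 'a rel \<Rightarrow> ('f, 'r, 'a) struct \<Rightarrow> ('f, 'r, 'a) indrel \<Rightarrow> bool" where
  "finite_witness_singletons K kbar C ind \<longleftrightarrow>
     (\<forall>M N. \<forall>b\<in>univ C. small_model K kbar C M \<and> small_model K kbar C N \<and> leK K M N \<longrightarrow>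
        (ind {b} M (univ N) \<longleftrightarrow> (\<forall>A. finite A \<and> A \<subseteq> univ N \<longrightarrow> ind {b} M A)))"

definition S_le ::
  "('f, 'r, 'a) aec \<Rightarrow> ('f, 'r, 'a) struct \<Rightarrow> ('f, 'r, 'a) struct \<Rightarrow> 'a rel \<Rightarrow>
   (unit, 'a) gtype set" where
  "S_le K C M \<mu> = {tp1 K C a (univ N) | a N. a \<in> univ C \<and> leK K N M \<and> |univ N| \<le>o \<mu>}"

definition NT ::
  "('f, 'r, 'a) aec \<Rightarrow> ('f, 'r, 'a) struct \<Rightarrow> 'a rel \<Rightarrow> 'a rel \<Rightarrow> 'c rel \<Rightarrow>
   (unit, 'a) gtype rel" where
  "NT K C \<mu> lam \<chi> = card_sup {|\<Gamma>| | \<Gamma>. \<exists>M. leK K M C \<and> |univ M| =o lam \<and> \<Gamma> \<subseteq> S_le K C M \<mu> \<and>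
     (\<forall>\<Delta>\<subseteq>\<Gamma>. \<chi> \<le>o |\<Delta>| \<longrightarrow> \<not> consistent K C \<Delta>)}"

end

theory Submission
  imports Defs
begin

text \<open>Write \<open>\<chi>\<close> for \<open>2\<close> to the power \<open>\<mu>\<close>. If the theorem fails, then by local character and pigeonhole there are
  more than \<open>\<chi>\<close> types \<open>tp(a/N)\<close>, \<open>|N| \<le> \<mu>\<close>, that do not fork over one and the same model \<open>M\<^sub>0\<close>, and no more
  than \<open>\<chi>\<close> of them are ever simultaneously realized. For a model \<open>R\<close> of size at most \<open>\<mu>\<close> and a type \<open>q\<close>
  over \<open>R\<close>, Zorn's lemma gives a maximal set of these types that is realized by a nonforking
  extension of \<open>q\<close> to a model \<open>P(R, q)\<close> of size at most \<open>\<chi>\<close>; the finite witness property takes care of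
  unions of chains. Since there are at most \<open>\<chi>\<close> types over \<open>R\<close>, there is a model \<open>W\<close> of size at
  most \<open>\<chi>\<close> that contains \<open>P(R, q)\<close> whenever it contains \<open>R\<close>. Take a type \<open>tp(a/N)\<close> in none of the
  maximal sets with \<open>R\<close> inside \<open>W\<close>. By local character \<open>N\<close> is independent from \<open>W\<close> over some such \<open>R\<close>,
  and type amalgamation over \<open>R\<close> adds \<open>tp(a/N)\<close> to a maximal set, a contradiction.\<close>

section \<open>Cardinals\<close>

text \<open>The chain axioms of an AEC speak of well-ordered chains only. Fix any well-order
  \<open>r\<close> of the chain and keep the members that strictly contain all
  \<open>r\<close>-smaller members: among these, strict inclusion is part of \<open>r\<close>, hence
  well-founded.\<close>

lemma chain_cofinal_wellorder:
  assumes chain: "\<And>A B. A \<in> \<C> \<Longrightarrow> B \<in> \<C> \<Longrightarrow> A \<subseteq> B \<or> B \<subseteq> A"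
  shows "\<exists>\<D>\<subseteq>\<C>. (\<forall>A\<in>\<C>. \<exists>B\<in>\<D>. A \<subseteq> B) \<and>
    well_order_on \<D> {(A, B). A \<in> \<D> \<and> B \<in> \<D> \<and> A \<subseteq> B}"
proof -
  obtain r where r: "well_order_on \<C> r" using well_order_on by blast
  then have wf: "wf (r - Id)" by (simp add: well_order_on_def)
  have tot: "(x, y) \<in> r \<or> (y, x) \<in> r" if "x \<in> \<C>" "y \<in> \<C>" "x \<noteq> y" for x y
    using r that unfolding well_order_on_def linear_order_on_def total_on_def by blast
  define \<D> where "\<D> = {x \<in> \<C>. \<forall>y\<in>\<C>. (y, x) \<in> r - Id \<longrightarrow> y \<subset> x}"
  let ?s = "{(A, B). A \<in> \<D> \<and> B \<in> \<D> \<and> A \<subseteq> B}"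
  have sub: "\<D> \<subseteq> \<C>" unfolding \<D>_def by blast
  have cof: "\<exists>B\<in>\<D>. A \<subseteq> B" if A: "A \<in> \<C>" for A
  proof -
    \<comment> \<open>The \<open>r\<close>-least member containing \<open>A\<close> is kept: an
      \<open>r\<close>-smaller \<open>y\<close> does not contain \<open>A\<close>, so the chain
      condition puts it strictly inside \<open>A\<close> and hence inside \<open>x\<close>.\<close>
    obtain x where x: "x \<in> {x \<in> \<C>. A \<subseteq> x}"
      and min: "\<And>y. (y, x) \<in> r - Id \<Longrightarrow> y \<notin> {x \<in> \<C>. A \<subseteq> x}"
      using wfE_min[OF wf, of A "{x \<in> \<C>. A \<subseteq> x}"] A by auto
    have "y \<subset> x" if "y \<in> \<C>" "(y, x) \<in> r - Id" for y
      using min[OF that(2)] that(1) chain[OF that(1) A] x by blast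
    then show ?thesis using x unfolding \<D>_def by blast
  qed
  have sr: "?s - Id \<subseteq> r - Id"
  proof (rule subrelI)
    fix A B assume "(A, B) \<in> ?s - Id"
    then have "A \<in> \<D>" "B \<in> \<D>" "A \<subseteq> B" "(A, B) \<notin> Id" by auto
    then have "(B, A) \<notin> r" unfolding \<D>_def by blast
    then show "(A, B) \<in> r - Id"
      using tot[of A B] \<open>A \<in> \<D>\<close> \<open>B \<in> \<D>\<close> \<open>(A, B) \<notin> Id\<close> sub by blast
  qed
  have "well_order_on \<D> ?s"
    unfolding well_order_on_def linear_order_on_def partial_order_on_def preorder_on_def
      refl_on_def total_on_def antisym_def trans_def
    using chain sub wf_subset[OF wf sr] by blast
  then show ?thesis using sub cof by blast
qed

section \<open>Suprema and powers of cardinals\<close>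

lemma not_ordLeq_iff: "Card_order r \<Longrightarrow> Card_order s \<Longrightarrow> \<not> r \<le>o s \<longleftrightarrow> s <o r"
  by (meson card_order_on_well_order_on not_ordLeq_iff_ordLess)

text \<open>By definition \<open>card_sup\<close> is least only among the bounds on its own type. A
  bound \<open>t\<close> on another type either has a copy on a subset of that type or is above the
  whole type, and the whole type is above every cardinal on it.\<close>

lemma card_sup_ordLeq:
  fixes t :: "'c rel"
  assumes "\<And>r. r \<in> R \<Longrightarrow> Card_order r" "\<And>r. r \<in> R \<Longrightarrow> r \<le>o t" "Card_order t"
  shows "card_sup R \<le>o t"
proof -
  have s: "is_card_sup R (card_sup R)" using is_card_sup_card_sup assms(1) by blast
  show ?thesis
  proof (cases "t \<le>o |UNIV :: 'a set|")
    case True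
    then obtain B :: "'a set" where "t =o |B|"
      using internalize_card_of_ordLeq2[of "Field t" "UNIV :: 'a set"] assms(3)
      by (meson card_of_Field_ordIso ordIso_ordLeq_trans ordIso_symmetric ordIso_transitive)
    then have "\<forall>r\<in>R. r \<le>o |B|" using assms(2) ordLeq_ordIso_trans by blast
    then have "card_sup R \<le>o |B|" using s card_of_Card_order unfolding is_card_sup_def by blast
    then show ?thesis using \<open>t =o |B|\<close> ordIso_symmetric ordLeq_ordIso_trans by blast
  next
    case False
    have "card_sup R \<le>o |UNIV :: 'a set|"
      using s unfolding is_card_sup_def
      by (metis card_of_Field_ordIso card_of_mono1 ordIso_ordLeq_trans ordIso_symmetric subset_UNIV)
    moreover have "|UNIV :: 'a set| \<le>o t"
      using False assms(3) not_ordLeq_iff card_of_Card_order ordLess_imp_ordLeq by blast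
    ultimately show ?thesis using ordLeq_transitive by blast
  qed
qed

lemma card_sup_upper:
  assumes "\<And>r. r \<in> R \<Longrightarrow> Card_order r" "r \<in> R"
  shows "r \<le>o card_sup R"
  using is_card_sup_card_sup[of R] assms unfolding is_card_sup_def by blast

lemma cexp_less_mono1:
  fixes r r' t :: "'a rel"
  assumes "Card_order r" "Card_order r'" "r \<le>o r'"
  shows "cexp_less r t \<le>o cexp_less r' t"
  unfolding cexp_less_def
proof (rule card_sup_ordLeq)
  let ?R = "{r' ^c s |s :: 'a rel. Card_order s \<and> s <o t}"
  show "Card_order (card_sup ?R)"
    using is_card_sup_card_sup[of ?R] Card_order_cexp unfolding is_card_sup_def by fastforce
  fix x assume "x \<in> {r ^c s |s :: 'a rel. Card_order s \<and> s <o t}"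
  then obtain s :: "'a rel" where s: "x = r ^c s" "Card_order s" "s <o t" by blast
  have "r' ^c s \<le>o card_sup ?R"
    by (rule card_sup_upper) (use s Card_order_cexp in blast)+
  then show "x \<le>o card_sup ?R"
    using cexp_mono1[OF assms(3) s(2)] s(1) ordLeq_transitive by blast
qed (auto simp: Card_order_cexp)

text \<open>Powers of 1 are 1, and the supremum over an empty set of exponents is 0, so in general
  only an inequality holds. It serves local character for sequences of length one.\<close>

lemma cexp_less_singleton: "cexp_less |{x :: 'a}| (t :: 'a rel) \<le>o cone"
  unfolding cexp_less_def
proof (rule card_sup_ordLeq)
  fix r assume "r \<in> {|{x}| ^c s |s :: 'a rel. Card_order s \<and> s <o t}"
  then obtain s :: "'a rel" where s: "r = |{x}| ^c s" by blast
  have "|Func (Field s) {x}| \<le>o |{()}|"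
    by (rule card_of_ordLeqI[of "\<lambda>_. ()"]) (auto simp: inj_on_def Func_def fun_eq_iff, metis)
  then show "r \<le>o cone" unfolding s cexp_def cone_def by (simp add: Field_card_of)
qed (auto simp: Card_order_cexp Card_order_cone)

section \<open>Counting bounded subsets, and a pigeonhole principle\<close>

text \<open>A nonempty set of size at most \<open>k\<close> is the range of a function on
  \<open>Field k\<close>. Members of \<open>Func\<close> are undefined off their domain, whence the
  change from \<open>f\<close> to \<open>?g\<close>.\<close>

lemma card_of_subsets_ordLeq_cexp:
  assumes k: "Card_order k"
  shows "|{A. A \<subseteq> X \<and> A \<noteq> {} \<and> |A| \<le>o k}| \<le>o |X| ^c k"
proof -
  have "{A. A \<subseteq> X \<and> A \<noteq> {} \<and> |A| \<le>o k} \<subseteq> (\<lambda>f. f ` Field k) ` Func (Field k) X"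
  proof clarify
    fix A assume A: "A \<subseteq> X" "A \<noteq> {}" "|A| \<le>o k"
    then have "|A| \<le>o |Field k|"
      using card_of_Field_ordIso[OF k] ordIso_symmetric ordLeq_ordIso_trans by blast
    then obtain f where f: "f ` Field k = A" using card_of_ordLeq2[OF A(2), of "Field k"] by metis
    let ?g = "\<lambda>x. if x \<in> Field k then f x else undefined"
    have "?g \<in> Func (Field k) X" using f A(1) by (auto simp: Func_def)
    moreover have "?g ` Field k = A" using f by auto
    ultimately show "A \<in> (\<lambda>f. f ` Field k) ` Func (Field k) X" by blast
  qed
  from surj_imp_ordLeq[OF this] show ?thesis by (simp add: cexp_def Field_card_of)
qed

text \<open>The power \<mu> of \<open>ctwo ^c \<mu>\<close> is
  \<open>ctwo ^c (\<mu> *c \<mu>)\<close>, and \<mu> is its own square.\<close>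

lemma card_of_bounded_subsets:
  assumes W: "|W| \<le>o ctwo ^c \<mu>" and \<mu>: "Cinfinite \<mu>"
  shows "|{A. A \<subseteq> W \<and> A \<noteq> {} \<and> |A| \<le>o \<mu>}| \<le>o ctwo ^c \<mu>"
proof -
  have "|{A. A \<subseteq> W \<and> A \<noteq> {} \<and> |A| \<le>o \<mu>}| \<le>o |W| ^c \<mu>"
    using card_of_subsets_ordLeq_cexp \<mu> by blast
  also have "|W| ^c \<mu> \<le>o (ctwo ^c \<mu>) ^c \<mu>" using cexp_mono1 W \<mu> by blast
  also have "(ctwo ^c \<mu>) ^c \<mu> =o ctwo ^c (\<mu> *c \<mu>)" using cexp_cprod Card_order_ctwo by blast
  also have "ctwo ^c (\<mu> *c \<mu>) =o ctwo ^c \<mu>"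
    using cexp_cong2 cprod_infinite \<mu> Card_order_ctwo Card_order_cprod by blast
  finally show ?thesis .
qed

text \<open>Pigeonhole: if all fibres had size at most \<theta>, then \<open>S\<close> would be a
  union of at most \<chi> sets of size at most \<chi>.\<close>

lemma card_of_fibre:
  assumes \<chi>: "Cinfinite \<chi>" and small: "|f ` S| \<le>o \<chi>" and big: "\<not> |S| \<le>o \<chi>"
    and \<theta>: "\<theta> \<le>o \<chi>"
  shows "\<exists>y\<in>f ` S. \<not> |{x \<in> S. f x = y}| \<le>o \<theta>"
proof (rule ccontr)
  assume "\<not> ?thesis"
  then have "\<forall>y\<in>f ` S. |{x \<in> S. f x = y}| \<le>o \<chi>"
    using \<theta> ordLeq_transitive by blast
  then have "|\<Union>y\<in>f ` S. {x \<in> S. f x = y}| \<le>o \<chi>" by (rule UNION_Cinfinite_bound[OF small _ \<chi>])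
  moreover have "(\<Union>y\<in>f ` S. {x \<in> S. f x = y}) = S" by blast
  ultimately show False using big by simp
qed

section \<open>Closing a set under a function of its small subsets\<close>

text \<open>The closing step is iterated along the successor cardinal of \<mu>. That cardinal is
  regular, so a subset of size at most \<mu> of the union already lies in one stage, and it is at
  most \<open>ctwo ^c \<mu>\<close>, so the union does not become too large. \<open>Q\<close> stands
  for the universes of models.\<close>

lemma closed_superset_exists:
  fixes F :: "'x set \<Rightarrow> 'x set" and \<mu> :: "'m rel"
  assumes \<mu>: "Cinfinite \<mu>"
    and QU: "\<And>B. B \<in> Q \<Longrightarrow> B \<subseteq> U"
    and hull: "\<And>A. A \<subseteq> U \<Longrightarrow> |A| \<le>o ctwo ^c \<mu> \<Longrightarrow> \<exists>B\<in>Q. A \<subseteq> B \<and> |B| \<le>o ctwo ^c \<mu>"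
    and F: "\<And>R. R \<subseteq> U \<Longrightarrow> R \<noteq> {} \<Longrightarrow> |R| \<le>o \<mu> \<Longrightarrow> F R \<subseteq> U \<and> |F R| \<le>o ctwo ^c \<mu>"
    and union: "\<And>\<C>. \<C> \<subseteq> Q \<Longrightarrow> \<C> \<noteq> {} \<Longrightarrow> (\<And>A B. A \<in> \<C> \<Longrightarrow> B \<in> \<C> \<Longrightarrow> A \<subseteq> B \<or> B \<subseteq> A) \<Longrightarrow> \<Union>\<C> \<in> Q"
    and W0: "W0 \<subseteq> U" "|W0| \<le>o ctwo ^c \<mu>"
  shows "\<exists>W\<in>Q. W0 \<subseteq> W \<and> |W| \<le>o ctwo ^c \<mu> \<and>
    (\<forall>R. R \<subseteq> W \<and> R \<noteq> {} \<and> |R| \<le>o \<mu> \<longrightarrow> F R \<subseteq> W)"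
proof -
  let ?\<chi> = "ctwo ^c \<mu>"
  have \<chi>: "Cinfinite ?\<chi>" using Cinfinite_cexp \<mu> ordLeq_refl Card_order_ctwo by blast
  have lt: "\<mu> <o ?\<chi>" using ordLess_ctwo_cexp \<mu> by blast
  let ?r = "cardSuc \<mu>"
  have r: "Card_order ?r" "Cinfinite ?r" "?r \<le>o ?\<chi>"
    using cardSuc_Card_order Cinfinite_cardSuc cardSuc_least[OF _ _ lt] \<mu> Card_order_cexp by blast+
  then have wr: "Well_order ?r" "wo_rel ?r"
    unfolding wo_rel_def using card_order_on_well_order_on by blast+
  define G where "G A = A \<union> W0 \<union> (\<Union>R\<in>{R. R \<subseteq> A \<and> R \<noteq> {} \<and> |R| \<le>o \<mu>}. F R)" for A
  have G: "G A \<subseteq> U \<and> |G A| \<le>o ?\<chi>" if "A \<subseteq> U" "|A| \<le>o ?\<chi>" for A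
  proof -
    let ?I = "{R. R \<subseteq> A \<and> R \<noteq> {} \<and> |R| \<le>o \<mu>}"
    have "|?I| \<le>o ?\<chi>" using card_of_bounded_subsets that(2) \<mu> by blast
    then have "|\<Union>R\<in>?I. F R| \<le>o ?\<chi>"
      using UNION_Cinfinite_bound[of ?I ?\<chi> F] \<chi> F that(1) by blast
    moreover have "|A \<union> W0| \<le>o ?\<chi>" using Un_Cinfinite_bound that(2) W0(2) \<chi> by blast
    ultimately have "|G A| \<le>o ?\<chi>" unfolding G_def using Un_Cinfinite_bound \<chi> by blast
    moreover have "G A \<subseteq> U" unfolding G_def using that(1) W0 F by blast
    ultimately show ?thesis by blast
  qed
  have "\<forall>A. \<exists>B. A \<subseteq> U \<and> |A| \<le>o ?\<chi> \<longrightarrow> B \<in> Q \<and> G A \<subseteq> B \<and> |B| \<le>o ?\<chi>"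
    using hull G by meson
  then obtain h where h: "\<And>A. A \<subseteq> U \<Longrightarrow> |A| \<le>o ?\<chi> \<Longrightarrow> h A \<in> Q \<and> G A \<subseteq> h A \<and> |h A| \<le>o ?\<chi>"
    by metis
  \<comment> \<open>Transfinite recursion: stage \<open>i\<close> is a hull, in \<open>Q\<close>, of
    one closing step \<open>G\<close> applied to the union of the earlier stages.\<close>
  define As where "As = wo_rel.worec ?r (\<lambda>f i. h (\<Union>j\<in>underS ?r i. f j))"
  have "wo_rel.adm_wo ?r (\<lambda>f i. h (\<Union>j\<in>underS ?r i. f j))"
    unfolding wo_rel.adm_wo_def[OF wr(2)] by (metis (no_types, lifting) SUP_cong)
  from wo_rel.worec_fixpoint[OF wr(2) this]
  have As: "As i = h (\<Union>j\<in>underS ?r i. As j)" for i unfolding As_def by metis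
  have un: "(\<Union>j\<in>underS ?r i. As j) \<subseteq> U \<and> |\<Union>j\<in>underS ?r i. As j| \<le>o ?\<chi>"
    if "\<And>j. j \<in> underS ?r i \<Longrightarrow> As j \<in> Q \<and> |As j| \<le>o ?\<chi>" for i
  proof -
    have "|underS ?r i| \<le>o |Field ?r|" by (intro card_of_mono1) (auto simp: underS_def Field_def)
    then have "|underS ?r i| \<le>o ?\<chi>"
      using card_of_Field_ordIso[OF r(1)] r(3) ordLeq_ordIso_trans ordLeq_transitive by blast
    then show ?thesis using UNION_Cinfinite_bound[of "underS ?r i" ?\<chi> As] \<chi> that QU by blast
  qed
  have bd: "As i \<in> Q \<and> |As i| \<le>o ?\<chi>" for i
  proof (rule wo_rel.well_order_induct[OF wr(2), of "\<lambda>i. As i \<in> Q \<and> |As i| \<le>o ?\<chi>"])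
    fix i assume "\<forall>j. j \<noteq> i \<and> (j, i) \<in> ?r \<longrightarrow> As j \<in> Q \<and> |As j| \<le>o ?\<chi>"
    then have "\<And>j. j \<in> underS ?r i \<Longrightarrow> As j \<in> Q \<and> |As j| \<le>o ?\<chi>" unfolding underS_def by blast
    from h[OF conjunct1[OF un[OF this]] conjunct2[OF un[OF this]]]
    show "As i \<in> Q \<and> |As i| \<le>o ?\<chi>" using As by metis
  qed
  have hi: "G (\<Union>j\<in>underS ?r i. As j) \<subseteq> As i" for i
    using h un bd As by metis
  have mono: "As i \<union> W0 \<union> (\<Union>R\<in>{R. R \<subseteq> As i \<and> R \<noteq> {} \<and> |R| \<le>o \<mu>}. F R) \<subseteq> As j"
    if "(i, j) \<in> ?r" "i \<noteq> j" for i j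
  proof -
    let ?V = "\<Union>j\<in>underS ?r j. As j"
    have "As i \<subseteq> ?V" using that unfolding underS_def by blast
    then have "As i \<union> W0 \<union> (\<Union>R\<in>{R. R \<subseteq> As i \<and> R \<noteq> {} \<and> |R| \<le>o \<mu>}. F R) \<subseteq> G ?V"
      unfolding G_def by (intro Un_mono UN_mono) auto
    then show ?thesis using hi[of j] by (rule subset_trans)
  qed
  have rc: "relChain ?r As" unfolding relChain_def using mono by blast
  let ?W = "\<Union>i\<in>Field ?r. As i"
  have lim: "\<exists>j\<in>Field ?r. i \<noteq> j \<and> (i, j) \<in> ?r" if "i \<in> Field ?r" for i
    using infinite_Card_order_limit[OF r(1) _ that] r(2) unfolding cinfinite_def by blast
  have ne: "Field ?r \<noteq> {}" using r(2) unfolding cinfinite_def by auto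
  have "\<Union>(As ` Field ?r) \<in> Q"
  proof (rule union)
    fix A B assume "A \<in> As ` Field ?r" "B \<in> As ` Field ?r"
    then obtain i j where "i \<in> Field ?r" "j \<in> Field ?r" "A = As i" "B = As j" by blast
    then show "A \<subseteq> B \<or> B \<subseteq> A"
      using wo_rel.TOTALS[OF wr(2)] rc unfolding relChain_def by blast
  qed (use bd ne in auto)
  moreover have "|?W| \<le>o ?\<chi>"
    using UNION_Cinfinite_bound[of "Field ?r" ?\<chi> As] \<chi> bd r card_of_Field_ordIso ordIso_ordLeq_trans
    by blast
  moreover have "W0 \<subseteq> ?W" using ne lim mono by blast
  \<comment> \<open>Regularity places \<open>R\<close> in a single stage; there is no last index, so
    a later stage contains \<open>F R\<close>.\<close>
  moreover have "F R \<subseteq> ?W" if R: "R \<subseteq> ?W" "R \<noteq> {}" "|R| \<le>o \<mu>" for R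
  proof -
    obtain i where i: "i \<in> Field ?r" "R \<subseteq> As i"
      using cardSuc_UNION_Cinfinite[OF \<mu> rc R(1,3)] by blast
    obtain j where j: "j \<in> Field ?r" "i \<noteq> j" "(i, j) \<in> ?r" using lim[OF i(1)] by blast
    have "F R \<subseteq> As j" using mono[OF j(3,2)] i(2) R(2,3) by blast
    then show ?thesis using j(1) by blast
  qed
  ultimately show ?thesis by (intro bexI[of _ ?W]) auto
qed

section \<open>Structures\<close>

lemma tuples_mono: "A \<subseteq> B \<Longrightarrow> xs \<in> tuples A n \<Longrightarrow> xs \<in> tuples B n"
  unfolding tuples_def by blast

lemma map_tuples: "xs \<in> tuples A n \<Longrightarrow> map h xs \<in> tuples (h ` A) n"
  unfolding tuples_def by auto

lemma tuples_Union_chain: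
  assumes ne: "\<C> \<noteq> {}" and chain: "\<And>A B. A \<in> \<C> \<Longrightarrow> B \<in> \<C> \<Longrightarrow> A \<subseteq> B \<or> B \<subseteq> A"
    and tup: "xs \<in> tuples (\<Union>\<C>) n"
  shows "\<exists>A\<in>\<C>. xs \<in> tuples A n"
proof -
  have "finite (set xs)" "set xs \<subseteq> \<Union>\<C>" using tup unfolding tuples_def by auto
  then have "\<exists>A\<in>\<C>. set xs \<subseteq> A"
  proof (induction rule: finite_induct)
    case empty then show ?case using ne by blast
  next
    case (insert x F)
    then obtain A B where "A \<in> \<C>" "F \<subseteq> A" "B \<in> \<C>" "x \<in> B" by blast
    then show ?case using chain[of A B] by blast
  qed
  then show ?thesis using tup unfolding tuples_def by blast
qed

lemma card_of_lists:
  assumes X: "|X| \<le>o r" and r: "Cinfinite r"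
  shows "|lists X| \<le>o r"
proof -
  have n: "|tuples X n| \<le>o r" for n
  proof (induction n)
    case 0
    have "tuples X 0 = {[]}" unfolding tuples_def by auto
    then show ?case using r Card_order_singl_ordLeq unfolding cinfinite_def
      by (metis infinite_imp_nonempty)
  next
    case (Suc n)
    have "tuples X (Suc n) \<subseteq> (\<lambda>(x, xs). x # xs) ` (X \<times> tuples X n)"
      unfolding tuples_def by (auto simp: length_Suc_conv image_iff)
    then have "|tuples X (Suc n)| \<le>o |X \<times> tuples X n|" by (rule surj_imp_ordLeq)
    also have "|X \<times> tuples X n| \<le>o r"
      using card_of_Times_ordLeq_infinite_Field r X Suc unfolding cinfinite_def by blast
    finally show ?case .
  qed
  have "|UNIV :: nat set| \<le>o r"
    using r infinite_iff_card_of_nat[of "Field r"] card_of_Field_ordIso ordLeq_ordIso_trans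
    unfolding cinfinite_def by blast
  then have "|\<Union>n. tuples X n| \<le>o r" using UNION_Cinfinite_bound[of UNIV r "tuples X"] n r by blast
  moreover have "lists X = (\<Union>n. tuples X n)" unfolding tuples_def by auto
  ultimately show ?thesis by simp
qed

section \<open>Substructures as restrictions, and isomorphisms\<close>

text \<open>Substructures of a fixed structure are determined by their universes. This allows models
  inside the monster to be handled as plain sets, ordered by inclusion.\<close>

definition restr :: "('f, 'r) language \<Rightarrow> ('f, 'r, 'a) struct \<Rightarrow> 'a set \<Rightarrow> ('f, 'r, 'a) struct" where
  "restr L C A =
     \<lparr>univ = A,
      fint = (\<lambda>f xs. if f \<in> funs L \<and> xs \<in> tuples A (fun_ar L f) then fint C f xs else undefined),
      rint = (\<lambda>R xs. R \<in> rels L \<and> xs \<in> tuples A (rel_ar L R) \<and> rint C R xs)\<rparr>"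

lemma univ_restr [simp]: "univ (restr L C A) = A"
  unfolding restr_def by simp

text \<open>The two structures agree on tuples from \<open>univ M\<close>; elsewhere
  \<open>is_struct\<close> forces on \<open>M\<close> exactly the default values that
  \<open>restr\<close> uses.\<close>

lemma substruct_eq_restr:
  assumes "substruct L M N" shows "M = restr L N (univ M)"
proof -
  have "fint M = fint (restr L N (univ M))" "rint M = rint (restr L N (univ M))"
    using assms unfolding substruct_def is_struct_def restr_def by (auto simp: fun_eq_iff) metis+
  then show ?thesis by simp
qed

lemma substruct_restr_iff:
  assumes "is_struct L C"
  shows "substruct L (restr L C A) C \<longleftrightarrow> A \<noteq> {} \<and> A \<subseteq> univ C \<and>
    (\<forall>f\<in>funs L. \<forall>xs\<in>tuples A (fun_ar L f). fint C f xs \<in> A)"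
  using assms unfolding substruct_def is_struct_def restr_def by auto

lemma substruct_restr_mono:
  assumes "substruct L (restr L C A) C" "substruct L (restr L C B) C" "A \<subseteq> B"
  shows "substruct L (restr L C A) (restr L C B)"
  using assms tuples_mono[OF assms(3)] unfolding substruct_def restr_def by auto

lemma is_iso_id: "is_struct L M \<Longrightarrow> is_iso L id M M"
  unfolding is_iso_def by simp

lemma is_iso_comp:
  assumes g: "is_iso L g M N" and h: "is_iso L h N P" shows "is_iso L (h \<circ> g) M P"
proof -
  have "g ` univ M = univ N" using g unfolding is_iso_def bij_betw_def by blast
  then have "map g xs \<in> tuples (univ N) n" if "xs \<in> tuples (univ M) n" for xs n
    using map_tuples[OF that, of g] by simp
  then show ?thesis using g h bij_betw_trans[of g "univ M" "univ N" h "univ P"]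
    unfolding is_iso_def by (auto simp flip: map_map)
qed

lemma is_iso_inv:
  assumes g: "is_iso L g M N"
  shows "is_iso L (inv_into (univ M) g) N M"
proof -
  let ?h = "inv_into (univ M) g"
  have b: "bij_betw g (univ M) (univ N)" and M: "is_struct L M"
    using g unfolding is_iso_def by blast+
  have gh: "g (?h y) = y" if "y \<in> univ N" for y
    using b that by (simp add: bij_betw_inv_into_right)
  have hg: "?h (g x) = x" if "x \<in> univ M" for x
    using b that by (simp add: bij_betw_inv_into_left)
  have img: "?h ` univ N = univ M" using bij_betw_inv_into[OF b] by (simp add: bij_betw_def)
  have t: "map ?h ys \<in> tuples (univ M) n" "map g (map ?h ys) = ys" if "ys \<in> tuples (univ N) n" for ys n
    using map_tuples[OF that, of ?h] img that gh
    by (auto simp: tuples_def subset_iff intro!: map_idI)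
  have "?h (fint N f ys) = fint M f (map ?h ys)"
    if f: "f \<in> funs L" "ys \<in> tuples (univ N) (fun_ar L f)" for f ys
  proof -
    have "g (fint M f (map ?h ys)) = fint N f ys"
      using g t[OF f(2)] f(1) unfolding is_iso_def by metis
    moreover have "fint M f (map ?h ys) \<in> univ M"
      using M t(1)[OF f(2)] f(1) unfolding is_struct_def by metis
    ultimately show ?thesis using hg by metis
  qed
  moreover have "rint N R ys = rint M R (map ?h ys)"
    if "R \<in> rels L" "ys \<in> tuples (univ N) (rel_ar L R)" for R ys
    using g t[OF that(2)] that(1) unfolding is_iso_def by metis
  ultimately show ?thesis
    using g bij_betw_inv_into[OF b] unfolding is_iso_def by blast
qed

lemma is_iso_cong:
  assumes "is_iso L g M N" "\<And>x. x \<in> univ M \<Longrightarrow> h x = g x"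
  shows "is_iso L h M N"
proof -
  have M: "is_struct L M" using assms(1) unfolding is_iso_def by blast
  have eq: "map h xs = map g xs" if "xs \<in> tuples (univ M) n" for xs n
    using that assms(2) by (auto simp: tuples_def)
  have "h (fint M f xs) = g (fint M f xs)" if "f \<in> funs L" "xs \<in> tuples (univ M) (fun_ar L f)" for f xs
    using M that assms(2) unfolding is_struct_def by metis
  moreover have "bij_betw h (univ M) (univ N)"
    using assms bij_betw_cong unfolding is_iso_def by metis
  ultimately show ?thesis using assms(1) unfolding is_iso_def by (simp add: eq del: map_eq_conv)
qed

section \<open>Submodels and types in a monster model\<close>

locale monster_model =
  fixes K :: "('f, 'r, 'a) aec" and kbar :: "'a rel" and C :: "('f, 'r, 'a) struct"
  assumes aec: "AEC K" and mon: "monster K kbar C"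
begin

abbreviation sub :: "'a set \<Rightarrow> ('f, 'r, 'a) struct" where
  "sub A \<equiv> restr (lang K) C A"

definition submodel :: "'a set \<Rightarrow> bool" where
  "submodel A \<longleftrightarrow> leK K (sub A) C"

abbreviation aut :: "('a \<Rightarrow> 'a) \<Rightarrow> bool" where
  "aut g \<equiv> is_iso (lang K) g C C"

text \<open>For \<open>A\<close>, \<open>a\<close> and \<open>b\<close> inside the monster this is
  equality of the Galois types of \<open>a\<close> and \<open>b\<close> over \<open>A\<close>,
  stated by an automorphism instead of orbits.\<close>

definition eqtp :: "'a set \<Rightarrow> 'a \<Rightarrow> 'a \<Rightarrow> bool" where
  "eqtp A a b \<longleftrightarrow> (\<exists>g. aut g \<and> (\<forall>x\<in>A. g x = x) \<and> g a = b)"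

lemmas aec_axioms = aec[unfolded AEC_def]
lemmas aec_struct = conjunct1[OF aec_axioms, rule_format]
lemmas aec_leK = conjunct1[OF conjunct2[OF aec_axioms], rule_format]
lemmas aec_refl = conjunct1[OF conjunct2[OF conjunct2[OF aec_axioms]], rule_format]
lemmas aec_trans = conjunct1[OF conjunct2[OF conjunct2[OF conjunct2[OF aec_axioms]]], rule_format]
lemmas aec_iso_leK = conjunct1[OF conjunct2[OF conjunct2[OF conjunct2[OF conjunct2[OF conjunct2[OF aec_axioms]]]]], rule_format]
lemmas aec_coherence = conjunct1[OF conjunct2[OF conjunct2[OF conjunct2[OF conjunct2[OF conjunct2[OF conjunct2[OF aec_axioms]]]]]], rule_format]
lemmas aec_union_leK = conjunct1[OF conjunct2[OF conjunct2[OF conjunct2[OF conjunct2[OF conjunct2[OF conjunct2[OF conjunct2[OF conjunct2[OF aec_axioms]]]]]]]], rule_format]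

lemma C_mods: "C \<in> mods K"
  using mon unfolding monster_def by blast

lemma C_struct: "is_struct (lang K) C"
  using aec_struct C_mods by blast

lemma C_leK: "leK K C C"
  using aec_refl C_mods by blast

lemma leK_substruct: "leK K M N \<Longrightarrow> substruct (lang K) M N"
  using aec_leK by blast

lemma leK_mods: "leK K M N \<Longrightarrow> M \<in> mods K"
  using aec_leK by blast

lemma leK_trans: "leK K M N \<Longrightarrow> leK K N P \<Longrightarrow> leK K M P"
  using aec_trans by blast

lemma leK_sub_eq: "leK K M C \<Longrightarrow> sub (univ M) = M"
  using substruct_eq_restr leK_substruct by metis

lemma leK_submodel: "leK K M C \<Longrightarrow> submodel (univ M)"
  unfolding submodel_def using leK_sub_eq by metis

lemma submodel_subset: "submodel A \<Longrightarrow> A \<subseteq> univ C"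
  and submodel_nonempty: "submodel A \<Longrightarrow> A \<noteq> {}"
  using leK_substruct substruct_restr_iff[OF C_struct] unfolding submodel_def by blast+

lemma submodel_substruct: "submodel A \<Longrightarrow> substruct (lang K) (sub A) C"
  unfolding submodel_def using leK_substruct by blast

text \<open>This is the coherence axiom with \<open>C\<close> as the common strong extension:
  between submodels, inclusion of the universes is enough.\<close>

lemma submodel_leK:
  assumes "submodel A" "submodel B" "A \<subseteq> B"
  shows "leK K (sub A) (sub B)"
proof -
  have "substruct (lang K) (sub A) (sub B)"
    using substruct_restr_mono submodel_substruct assms by blast
  then show ?thesis using aec_coherence assms(1,2) unfolding submodel_def by blast
qed

text \<open>A well-ordered cofinal subchain has the same union, and the union of such a chain lies
  strongly in every common strong extension of its members, here in \<open>C\<close>.\<close>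

lemma submodel_Union_chain:
  assumes sub: "\<And>A. A \<in> \<C> \<Longrightarrow> submodel A" and ne: "\<C> \<noteq> {}"
    and chain: "\<And>A B. A \<in> \<C> \<Longrightarrow> B \<in> \<C> \<Longrightarrow> A \<subseteq> B \<or> B \<subseteq> A"
  shows "submodel (\<Union>\<C>)"
proof -
  obtain \<D> where \<D>: "\<D> \<subseteq> \<C>" "\<forall>A\<in>\<C>. \<exists>B\<in>\<D>. A \<subseteq> B"
    "well_order_on \<D> {(A, B). A \<in> \<D> \<and> B \<in> \<D> \<and> A \<subseteq> B}"
    using chain_cofinal_wellorder[of \<C>, OF chain] by blast
  let ?U = "\<Union>\<C>"
  have UD: "?U = \<Union>\<D>" using \<D>(1,2) by blast
  have Dsub: "submodel A" if "A \<in> \<D>" for A using that \<D>(1) sub by blast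
  have leq: "leK K (sub A) (sub B) \<longleftrightarrow> A \<subseteq> B" if "A \<in> \<D>" "B \<in> \<D>" for A B
    using submodel_leK Dsub that leK_substruct[of "sub A" "sub B"] unfolding substruct_def by auto
  have cl: "fint C f xs \<in> ?U" if "f \<in> funs (lang K)" and xs: "xs \<in> tuples ?U (fun_ar (lang K) f)" for f xs
  proof -
    obtain A where A: "A \<in> \<C>" "xs \<in> tuples A (fun_ar (lang K) f)"
      using tuples_Union_chain[OF ne chain xs] by blast
    then have "fint C f xs \<in> A"
      using submodel_substruct[OF sub] substruct_restr_iff[OF C_struct] that(1) by blast
    then show ?thesis using A(1) by blast
  qed
  have "?U \<noteq> {}" "?U \<subseteq> univ C" using sub ne submodel_subset submodel_nonempty by blast+
  then have U: "substruct (lang K) (sub ?U) C" using substruct_restr_iff[OF C_struct] cl by blast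
  have inj: "inj_on sub \<D>" by (rule inj_onI) (metis univ_restr)
  let ?r = "{(A, B). A \<in> \<D> \<and> B \<in> \<D> \<and> A \<subseteq> B}"
  let ?s = "{(M, N). M \<in> sub ` \<D> \<and> N \<in> sub ` \<D> \<and> leK K M N}"
  \<comment> \<open>By coherence the strong substructure order on the structures
    \<open>sub A\<close> is the image of the inclusion order, so the well-order is carried over by
    the injection \<open>sub\<close>.\<close>
  have s: "?s = dir_image ?r sub" unfolding dir_image_def using leq by fastforce
  have F: "Field ?r = \<D>" by (auto simp: Field_def)
  have "Well_order ?r" using \<D>(3) F by simp
  then have "Well_order ?s" unfolding s by (rule Well_order_dir_image) (simp add: F inj)
  moreover have "Field ?s = sub ` \<D>" unfolding s dir_image_Field F ..
  ultimately have "well_order_on (sub ` \<D>) ?s" by simp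
  then have "chain_union K (sub ` \<D>) (sub ?U)"
    unfolding chain_union_def
  proof (intro conjI)
    show "sub ` \<D> \<noteq> {}" using \<D>(2) ne by blast
    show "sub ` \<D> \<subseteq> mods K" using Dsub leK_mods unfolding submodel_def by blast
    show "is_struct (lang K) (sub ?U)" using U unfolding substruct_def by blast
    show "univ (sub ?U) = (\<Union>M\<in>sub ` \<D>. univ M)" using UD by simp
    show "\<forall>M\<in>sub ` \<D>. substruct (lang K) M (sub ?U)"
      using substruct_restr_mono[OF submodel_substruct U] Dsub UD by blast
  qed
  moreover have "\<forall>M\<in>sub ` \<D>. leK K M C" using Dsub unfolding submodel_def by blast
  ultimately show ?thesis using aec_union_leK unfolding submodel_def by blast
qed

section \<open>Automorphisms of the monster model\<close>

lemma aut_id: "aut id" using is_iso_id C_struct by blast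

lemma aut_bij: "aut g \<Longrightarrow> bij_betw g (univ C) (univ C)" unfolding is_iso_def by blast

lemma aut_in: "aut g \<Longrightarrow> x \<in> univ C \<Longrightarrow> g x \<in> univ C"
  using aut_bij bij_betwE by metis

lemma aut_inj: "aut g \<Longrightarrow> inj_on g (univ C)" using aut_bij bij_betw_def by metis

lemma aut_inverse:
  assumes "aut g"
  shows "\<exists>h. aut h \<and> (\<forall>x\<in>univ C. h (g x) = x \<and> g (h x) = x)"
  using is_iso_inv[OF assms] aut_bij[OF assms] bij_betw_inv_into_left bij_betw_inv_into_right by fast

text \<open>The relation \<open>leK\<close> is invariant under isomorphisms, used here with
  \<open>g\<close> on \<open>C\<close> and its restriction on \<open>A\<close>. Pulling tuples back
  along \<open>g\<close> shows that the image of \<open>A\<close> is closed under the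
  functions.\<close>

lemma aut_image:
  assumes g: "aut g" and A: "submodel A"
  shows "is_iso (lang K) g (sub A) (sub (g ` A))" and "submodel (g ` A)"
proof -
  have AC: "A \<subseteq> univ C" using submodel_subset A by blast
  have sA: "substruct (lang K) (sub A) C" using submodel_substruct A by blast
  have cl: "fint C f xs \<in> A" if "f \<in> funs (lang K)" "xs \<in> tuples A (fun_ar (lang K) f)" for f xs
    using sA substruct_restr_iff[OF C_struct] that by blast
  have fg: "g (fint C f xs) = fint C f (map g xs)"
    if "f \<in> funs (lang K)" "xs \<in> tuples A (fun_ar (lang K) f)" for f xs
    using g that tuples_mono[OF AC] unfolding is_iso_def by blast
  have rg: "rint C R xs = rint C R (map g xs)"
    if "R \<in> rels (lang K)" "xs \<in> tuples A (rel_ar (lang K) R)" for R xs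
    using g that tuples_mono[OF AC] unfolding is_iso_def by blast
  have pre: "\<exists>xs\<in>tuples A n. ys = map g xs" if "ys \<in> tuples (g ` A) n" for ys n
  proof -
    have "ys \<in> lists (g ` A)" using that unfolding tuples_def by auto
    then obtain xs where "xs \<in> lists A" "ys = map g xs" by (auto simp: lists_image)
    then show ?thesis using that unfolding tuples_def by auto
  qed
  have cl': "fint C f ys \<in> g ` A" if f: "f \<in> funs (lang K)" and ys: "ys \<in> tuples (g ` A) (fun_ar (lang K) f)" for f ys
  proof -
    obtain xs where xs: "xs \<in> tuples A (fun_ar (lang K) f)" "ys = map g xs" using pre[OF ys] by blast
    then show ?thesis using fg[OF f xs(1)] cl[OF f xs(1)] by force
  qed
  have "g ` A \<subseteq> univ C" "g ` A \<noteq> {}"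
    using AC aut_in[OF g] submodel_nonempty[OF A] by blast+
  then have sg: "substruct (lang K) (sub (g ` A)) C"
    using substruct_restr_iff[OF C_struct] cl' by blast
  have "bij_betw g A (g ` A)" using aut_inj[OF g] AC inj_on_subset inj_on_imp_bij_betw by blast
  moreover have "is_struct (lang K) (sub A)" "is_struct (lang K) (sub (g ` A))"
    using sA sg unfolding substruct_def by blast+
  ultimately show iso: "is_iso (lang K) g (sub A) (sub (g ` A))"
    unfolding is_iso_def using cl fg rg map_tuples[of _ A _ g] by (auto simp: restr_def)
  show "submodel (g ` A)" using A g iso aec_iso_leK unfolding submodel_def by blast
qed

lemma aut_extend:
  assumes "submodel A" "submodel B" "|A| <o kbar" "is_iso (lang K) h (sub A) (sub B)"
  shows "\<exists>g. aut g \<and> (\<forall>x\<in>A. g x = h x)"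
  using assms mon unfolding monster_def submodel_def by (metis univ_restr)

section \<open>Galois types as orbits\<close>

lemma eqtp_refl: "eqtp A a a" unfolding eqtp_def using aut_id by fastforce

lemma eqtp_trans: "eqtp A a b \<Longrightarrow> eqtp A b c \<Longrightarrow> eqtp A a c"
  unfolding eqtp_def using is_iso_comp by (metis comp_apply)

lemma eqtp_sym:
  assumes "eqtp A a b" "A \<subseteq> univ C" "a \<in> univ C" shows "eqtp A b a"
proof -
  obtain g where g: "aut g" "\<forall>x\<in>A. g x = x" "g a = b" using assms(1) unfolding eqtp_def by blast
  obtain h where "aut h" "\<forall>x\<in>univ C. h (g x) = x" using aut_inverse[OF g(1)] by blast
  then show ?thesis using g assms unfolding eqtp_def by (metis subset_iff)
qed

lemma eqtp_mono: "eqtp A a b \<Longrightarrow> B \<subseteq> A \<Longrightarrow> eqtp B a b"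
  unfolding eqtp_def by blast

lemma eqtp_in: "eqtp A a b \<Longrightarrow> a \<in> univ C \<Longrightarrow> b \<in> univ C"
  unfolding eqtp_def using aut_in by blast

text \<open>The orbit of \<open>b\<close> over \<open>B\<close> lies in the orbit of
  \<open>b'\<close> over \<open>A\<close> as soon as \<open>b\<close> itself does, because
  automorphisms fixing \<open>B\<close> fix \<open>A\<close>. Membership of \<open>b\<close> gives
  an automorphism from \<open>b'\<close> to \<open>b\<close>, which is then inverted. Both extension
  and equality of types reduce to this.\<close>

lemma gtp_subset_iff:
  assumes b: "b \<in> I \<rightarrow> univ C" and b': "b' \<in> I \<rightarrow> univ C" and A: "A \<subseteq> univ C" "A \<subseteq> B"
  shows "snd (gtp K C I b B) \<subseteq> snd (gtp K C I b' A) \<longleftrightarrow>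
    (\<exists>g. aut g \<and> (\<forall>x\<in>A. g x = x) \<and> (\<forall>i\<in>I. g (b i) = b' i))"
proof
  assume "snd (gtp K C I b B) \<subseteq> snd (gtp K C I b' A)"
  moreover have "restrict (id \<circ> b) I \<in> snd (gtp K C I b B)"
    unfolding gtp_def using aut_id by (auto intro!: exI[of _ id])
  ultimately obtain g where g: "aut g" "\<forall>x\<in>A. g x = x" "restrict b I = restrict (g \<circ> b') I"
    unfolding gtp_def by auto
  have eq: "b i = g (b' i)" if "i \<in> I" for i
    using fun_cong[OF g(3), of i] that by simp
  obtain h where h: "aut h" "\<forall>x\<in>univ C. h (g x) = x" using aut_inverse[OF g(1)] by blast
  have "h (b i) = b' i" if "i \<in> I" for i using eq h(2) b' that by (metis PiE)
  moreover have "h x = x" if "x \<in> A" for x using g(2) h(2) A that by (metis subset_iff)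
  ultimately show "\<exists>g. aut g \<and> (\<forall>x\<in>A. g x = x) \<and> (\<forall>i\<in>I. g (b i) = b' i)" using h(1) by blast
next
  assume "\<exists>g. aut g \<and> (\<forall>x\<in>A. g x = x) \<and> (\<forall>i\<in>I. g (b i) = b' i)"
  then obtain g where g: "aut g" "\<forall>x\<in>A. g x = x" "\<forall>i\<in>I. g (b i) = b' i" by blast
  obtain h where h: "aut h" "\<forall>x\<in>univ C. h (g x) = x" using aut_inverse[OF g(1)] by blast
  have hb: "h (b' i) = b i" if "i \<in> I" for i using g(3) h(2) b that by (metis PiE)
  have hA: "h x = x" if "x \<in> A" for x using g(2) h(2) A that by (metis subset_iff)
  have "restrict (f \<circ> b) I \<in> snd (gtp K C I b' A)" if f: "aut f" "\<forall>x\<in>B. f x = x" for f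
  proof -
    have "restrict (f \<circ> b) I = restrict ((f \<circ> h) \<circ> b') I" using hb by (auto simp: fun_eq_iff)
    moreover have "aut (f \<circ> h)" using is_iso_comp h(1) f(1) by blast
    moreover have "\<forall>x\<in>A. (f \<circ> h) x = x" using hA f(2) A(2) by auto
    ultimately show ?thesis unfolding gtp_def by fastforce
  qed
  then show "snd (gtp K C I b B) \<subseteq> snd (gtp K C I b' A)" unfolding gtp_def by auto
qed

lemma gtp_eq_iff:
  assumes b: "b \<in> I \<rightarrow> univ C" and b': "b' \<in> I \<rightarrow> univ C" and A: "A \<subseteq> univ C"
  shows "gtp K C I b A = gtp K C I b' A \<longleftrightarrow>
    (\<exists>g. aut g \<and> (\<forall>x\<in>A. g x = x) \<and> (\<forall>i\<in>I. g (b i) = b' i))" (is "_ \<longleftrightarrow> ?R b b'")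
proof -
  have "?R b' b" if R: "?R b b'"
  proof -
    obtain g where g: "aut g" "\<forall>x\<in>A. g x = x" "\<forall>i\<in>I. g (b i) = b' i" using R by blast
    obtain h where h: "aut h" "\<forall>x\<in>univ C. h (g x) = x" using aut_inverse[OF g(1)] by blast
    have "h (b' i) = b i" if "i \<in> I" for i using g(3) h(2) b that by (metis PiE)
    moreover have "h x = x" if "x \<in> A" for x using g(2) h(2) A that by (metis subset_iff)
    ultimately show ?thesis using h(1) by blast
  qed
  moreover have "gtp K C I b A = gtp K C I b' A \<longleftrightarrow>
      snd (gtp K C I b A) \<subseteq> snd (gtp K C I b' A) \<and> snd (gtp K C I b' A) \<subseteq> snd (gtp K C I b A)"
    unfolding gtp_def by auto
  ultimately show ?thesis
    unfolding gtp_subset_iff[OF b b' A subset_refl] gtp_subset_iff[OF b' b A subset_refl] by argo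
qed

lemma fst_gtp [simp]: "fst (gtp K C I b A) = A" unfolding gtp_def by simp

lemma extends_gtp_iff:
  assumes "b \<in> I \<rightarrow> univ C" "b' \<in> I \<rightarrow> univ C" "A \<subseteq> univ C"
  shows "extends (gtp K C I b B) (gtp K C I b' A) \<longleftrightarrow>
    A \<subseteq> B \<and> (\<exists>g. aut g \<and> (\<forall>x\<in>A. g x = x) \<and> (\<forall>i\<in>I. g (b i) = b' i))"
  unfolding extends_def using gtp_subset_iff[OF assms] by auto

lemma gtp_singleton_eq_iff:
  assumes "a \<in> univ C" "b \<in> univ C" "A \<subseteq> univ C" "I \<noteq> {}"
  shows "gtp K C I (\<lambda>_. a) A = gtp K C I (\<lambda>_. b) A \<longleftrightarrow> eqtp A a b"
  using gtp_eq_iff[of "\<lambda>_. a" I "\<lambda>_. b" A] assms unfolding eqtp_def by auto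

lemma tp1_eq_iff:
  assumes "a \<in> univ C" "b \<in> univ C" "A \<subseteq> univ C"
  shows "tp1 K C a A = tp1 K C b A \<longleftrightarrow> eqtp A a b"
  unfolding tp1_def using gtp_singleton_eq_iff[OF assms] by blast

lemma fst_tp1 [simp]: "fst (tp1 K C a A) = A" unfolding tp1_def by simp

section \<open>Gluing embeddings along a chain, and small hulls\<close>

text \<open>The union of the graphs is the graph of an isomorphism \<open>h\<close> between
  submodels: tuples are finite, so each condition on \<open>h\<close> can be checked in a single
  member of the chain. Homogeneity of the monster extends \<open>h\<close> to an automorphism; this
  is where the size bound enters.\<close>

lemma aut_glue:
  assumes ne: "\<H> \<noteq> {}" and chain: "\<And>G H. G \<in> \<H> \<Longrightarrow> H \<in> \<H> \<Longrightarrow> G \<subseteq> H \<or> H \<subseteq> G"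
    and aut: "\<And>H. H \<in> \<H> \<Longrightarrow> submodel (Domain H) \<and> (\<exists>g. aut g \<and> (\<forall>(x, y)\<in>H. g x = y))"
    and small: "|Domain (\<Union>\<H>)| <o kbar"
  shows "submodel (Domain (\<Union>\<H>)) \<and> (\<exists>g. aut g \<and> (\<forall>(x, y)\<in>\<Union>\<H>. g x = y))"
proof -
  let ?P = "Domain (\<Union>\<H>)" and ?Q = "Range (\<Union>\<H>)"
  have P: "?P = \<Union>(Domain ` \<H>)" and Q: "?Q = \<Union>(Range ` \<H>)" by auto
  have chD: "A \<subseteq> B \<or> B \<subseteq> A" if "A \<in> Domain ` \<H>" "B \<in> Domain ` \<H>" for A B
    using that chain Domain_mono by blast
  have chR: "A \<subseteq> B \<or> B \<subseteq> A" if "A \<in> Range ` \<H>" "B \<in> Range ` \<H>" for A B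
    using that chain Range_mono by blast
  obtain a where a: "\<And>H. H \<in> \<H> \<Longrightarrow> aut (a H)" "\<And>H x y. H \<in> \<H> \<Longrightarrow> (x, y) \<in> H \<Longrightarrow> a H x = y"
  proof -
    have "\<forall>H. \<exists>g. H \<in> \<H> \<longrightarrow> aut g \<and> (\<forall>(x, y)\<in>H. g x = y)" using aut by blast
    then obtain a where "\<And>H. H \<in> \<H> \<Longrightarrow> aut (a H) \<and> (\<forall>(x, y)\<in>H. a H x = y)" by metis
    then show ?thesis by (intro that[of a]) fast+
  qed
  have RD: "Range H = a H ` Domain H" if "H \<in> \<H>" for H using a(2)[OF that] by force
  have sR: "submodel A" if "A \<in> Range ` \<H>" for A using that RD aut a(1) aut_image(2) by force
  have sD: "submodel A" if "A \<in> Domain ` \<H>" for A using that aut by blast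
  have subP: "submodel ?P" unfolding P using submodel_Union_chain[OF sD _ chD] ne by blast
  have subQ: "submodel ?Q" unfolding Q using submodel_Union_chain[OF sR _ chR] ne by blast
  define h where "h x = (THE y. (x, y) \<in> \<Union>\<H>)" for x
  have uniq: "y = z" if xyz: "(x, y) \<in> \<Union>\<H>" "(x, z) \<in> \<Union>\<H>" for x y z
  proof -
    obtain G H where "G \<in> \<H>" "(x, y) \<in> G" "H \<in> \<H>" "(x, z) \<in> H" using xyz by blast
    then show ?thesis using chain[of G H] a(2) by (metis subsetD)
  qed
  have h: "h x = y" if "(x, y) \<in> \<Union>\<H>" for x y
    unfolding h_def using that uniq by blast
  have ha: "h x = a H x" if "H \<in> \<H>" "x \<in> Domain H" for H x
    using that h a(2)[OF that(1)] by blast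
  have isoH: "is_iso (lang K) h (sub (Domain H)) (sub (Range H))" if "H \<in> \<H>" for H
  proof (rule is_iso_cong)
    show "is_iso (lang K) (a H) (sub (Domain H)) (sub (Range H))"
      unfolding RD[OF that] using aut_image(1)[OF a(1)[OF that]] aut[OF that] by blast
    show "\<And>x. x \<in> univ (sub (Domain H)) \<Longrightarrow> h x = a H x" using ha[OF that] by simp
  qed
  have tup: "\<exists>H\<in>\<H>. xs \<in> tuples (Domain H) n" if "xs \<in> tuples ?P n" for xs n
    using tuples_Union_chain[of "Domain ` \<H>" xs n] chD ne that unfolding P by blast
  have strs: "is_struct (lang K) (sub ?P)" "is_struct (lang K) (sub ?Q)"
    using submodel_substruct subP subQ unfolding substruct_def by blast+
  have inj: "inj_on h ?P"
  proof (rule inj_onI)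
    fix x y assume xy: "x \<in> ?P" "y \<in> ?P" "h x = h y"
    \<comment> \<open>Viewing the two elements as one tuple yields a single member of the chain
      whose domain contains both.\<close>
    then have "[x, y] \<in> tuples ?P 2" unfolding tuples_def by auto
    then obtain H where "H \<in> \<H>" "[x, y] \<in> tuples (Domain H) 2" using tup by blast
    then have H: "H \<in> \<H>" "x \<in> Domain H" "y \<in> Domain H" unfolding tuples_def by simp_all
    have "inj_on h (Domain H)" using isoH[OF H(1)] unfolding is_iso_def bij_betw_def by simp
    then show "x = y" using H xy(3) inj_onD by metis
  qed
  have img: "h ` ?P = ?Q" using h by force
  have "is_iso (lang K) h (sub ?P) (sub ?Q)"
    unfolding is_iso_def
  proof (intro conjI ballI)
    show "bij_betw h (univ (sub ?P)) (univ (sub ?Q))" using inj img by (simp add: bij_betw_def)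
  next
    fix f xs assume f: "f \<in> funs (lang K)" and "xs \<in> tuples (univ (sub ?P)) (fun_ar (lang K) f)"
    then have xs: "xs \<in> tuples ?P (fun_ar (lang K) f)" by simp
    then obtain H where H: "H \<in> \<H>" "xs \<in> tuples (Domain H) (fun_ar (lang K) f)" using tup by blast
    then have "h (fint (sub (Domain H)) f xs) = fint (sub (Range H)) f (map h xs)"
      using isoH f unfolding is_iso_def by simp
    moreover have "map h xs \<in> tuples (Range H) (fun_ar (lang K) f)"
      using map_tuples[OF H(2), of h] ha[OF H(1)] RD[OF H(1)] by simp
    moreover have "map h xs \<in> tuples ?Q (fun_ar (lang K) f)"
      using map_tuples[OF xs, of h] img by simp
    ultimately show "h (fint (sub ?P) f xs) = fint (sub ?Q) f (map h xs)"
      using f xs H(2) by (simp add: restr_def)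
  next
    fix R xs assume f: "R \<in> rels (lang K)" and "xs \<in> tuples (univ (sub ?P)) (rel_ar (lang K) R)"
    then have xs: "xs \<in> tuples ?P (rel_ar (lang K) R)" by simp
    then obtain H where H: "H \<in> \<H>" "xs \<in> tuples (Domain H) (rel_ar (lang K) R)" using tup by blast
    then have "rint (sub (Domain H)) R xs = rint (sub (Range H)) R (map h xs)"
      using isoH f unfolding is_iso_def by simp
    moreover have "map h xs \<in> tuples (Range H) (rel_ar (lang K) R)"
      using map_tuples[OF H(2), of h] ha[OF H(1)] RD[OF H(1)] by simp
    moreover have "map h xs \<in> tuples ?Q (rel_ar (lang K) R)"
      using map_tuples[OF xs, of h] img by simp
    ultimately show "rint (sub ?P) R xs = rint (sub ?Q) R (map h xs)"
      using f xs H(2) by (simp add: restr_def)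
  qed (use strs in auto)
  then obtain g where "aut g" "\<forall>x\<in>?P. g x = h x"
    using aut_extend[OF subP subQ small] by blast
  moreover have "x \<in> ?P \<and> h x = y" if "(x, y) \<in> \<Union>\<H>" for x y using that h by blast
  ultimately have "aut g \<and> (\<forall>(x, y)\<in>\<Union>\<H>. g x = y)" by fastforce
  then show ?thesis using subP by blast
qed

lemma hull_exists:
  assumes LS: "LST_bound K LS" "LS \<le>o r" "Cinfinite r"
    and W: "submodel W" "A \<subseteq> W" and A: "|A| \<le>o r"
  obtains B where "submodel B" "A \<subseteq> B" "B \<subseteq> W" "|B| \<le>o r"
proof -
  have "sub W \<in> mods K" using W(1) leK_mods unfolding submodel_def by blast
  then obtain N where N: "leK K N (sub W)" "A \<subseteq> univ N" "|univ N| \<le>o |A| +c LS"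
    using LS(1) W(2) unfolding LST_bound_def by (metis univ_restr)
  have "|A| +c LS \<le>o r"
    using csum_cinfinite_bound[OF A LS(2) card_of_Card_order _ LS(3)] LS(1)
    unfolding LST_bound_def by blast
  then have "|univ N| \<le>o r" using N(3) ordLeq_transitive by blast
  moreover have "submodel (univ N)"
    using N(1) W(1) leK_trans leK_submodel unfolding submodel_def by blast
  moreover have "univ N \<subseteq> W" using leK_substruct[OF N(1)] unfolding substruct_def by simp
  ultimately show ?thesis using that N(2) by blast
qed

end

section \<open>Counting the types over a model\<close>

lemma Plus_eq_iff: "A <+> B = A' <+> B' \<longleftrightarrow> A = A' \<and> B = B'"
  by (auto simp: set_eq_iff Plus_def image_iff)

context monster_model
begin

text \<open>The injections \<open>e\<close> and \<open>e'\<close> copy the two models onto one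
  common set, and by \<open>F\<close> and \<open>R\<close> the copied functions and relations
  coincide. Going out along \<open>e\<close> and back along \<open>e'\<close> therefore preserves
  the structure.\<close>

lemma is_iso_of_codes:
  assumes N: "submodel N" "submodel N'" and e: "inj_on e N" "inj_on e' N'" "e ` N = e' ` N'"
    and F: "{(f, map e xs, e (fint C f xs)) |f xs. f \<in> funs (lang K) \<and> xs \<in> tuples N (fun_ar (lang K) f)} =
            {(f, map e' xs, e' (fint C f xs)) |f xs. f \<in> funs (lang K) \<and> xs \<in> tuples N' (fun_ar (lang K) f)}"
    and R: "{(R, map e xs) |R xs. R \<in> rels (lang K) \<and> xs \<in> tuples N (rel_ar (lang K) R) \<and> rint C R xs} =
            {(R, map e' xs) |R xs. R \<in> rels (lang K) \<and> xs \<in> tuples N' (rel_ar (lang K) R) \<and> rint C R xs}"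
    (is "?R = ?R'")
  shows "is_iso (lang K) (inv_into N' e' \<circ> e) (sub N) (sub N')"
proof -
  let ?h = "inv_into N' e' \<circ> e"
  have e'h: "e' (?h x) = e x" if "x \<in> N" for x
    using that e(3) f_inv_into_f[of "e x" e' N'] by auto
  have bij: "bij_betw ?h N N'"
    using bij_betw_trans[OF inj_on_imp_bij_betw[OF e(1)], of "inv_into N' e'" N']
      bij_betw_inv_into[OF inj_on_imp_bij_betw[OF e(2)]] e(3) by simp
  have hN: "?h ` N = N'" using bij unfolding bij_betw_def by blast
  have ht: "map ?h xs \<in> tuples N' n" if "xs \<in> tuples N n" for xs n
    using map_tuples[OF that, of ?h] hN by simp
  have mm: "map e' (map ?h xs) = map e xs" if "xs \<in> tuples N n" for xs n
    using that e'h unfolding tuples_def by auto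
  have uniq: "ys = map ?h xs" if xs: "xs \<in> tuples N n" and ys: "ys \<in> tuples N' m" "map e xs = map e' ys" for xs ys n m
  proof (rule map_inj_on)
    show "map e' ys = map e' (map ?h xs)" using mm[OF xs] ys(2) by simp
    show "inj_on e' (set ys \<union> set (map ?h xs))"
      by (rule inj_on_subset[OF e(2)]) (use ys(1) ht[OF xs] in \<open>unfold tuples_def, blast\<close>)
  qed
  have cl: "fint C f xs \<in> N" if "f \<in> funs (lang K)" "xs \<in> tuples N (fun_ar (lang K) f)" for f xs
    using submodel_substruct[OF N(1)] substruct_restr_iff[OF C_struct] that by blast
  have cl': "fint C f xs \<in> N'" if "f \<in> funs (lang K)" "xs \<in> tuples N' (fun_ar (lang K) f)" for f xs
    using submodel_substruct[OF N(2)] substruct_restr_iff[OF C_struct] that by blast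
  have fh: "?h (fint C f xs) = fint C f (map ?h xs)"
    if f: "f \<in> funs (lang K)" and xs: "xs \<in> tuples N (fun_ar (lang K) f)" for f xs
  proof -
    have "(f, map e xs, e (fint C f xs)) \<in> {(f, map e' xs, e' (fint C f xs)) |f xs.
        f \<in> funs (lang K) \<and> xs \<in> tuples N' (fun_ar (lang K) f)}"
      unfolding F[symmetric] using f xs by blast
    then obtain ys where ys: "ys \<in> tuples N' (fun_ar (lang K) f)" "map e xs = map e' ys"
        "e (fint C f xs) = e' (fint C f ys)" by auto
    then have "ys = map ?h xs" using uniq xs by blast
    then have "e' (?h (fint C f xs)) = e' (fint C f (map ?h xs))" using ys(3) e'h cl[OF f xs] by metis
    moreover have "?h (fint C f xs) \<in> N'" using hN cl[OF f xs] by blast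
    ultimately show ?thesis using inj_onD[OF e(2)] cl'[OF f ht[OF xs]] by blast
  qed
  have rh: "rint C R xs \<longleftrightarrow> rint C R (map ?h xs)"
    if r: "R \<in> rels (lang K)" and xs: "xs \<in> tuples N (rel_ar (lang K) R)" for R xs
  proof
    assume "rint C R xs"
    then have "(R, map e xs) \<in> ?R'" unfolding R[symmetric] using r xs by blast
    then obtain ys where ys: "ys \<in> tuples N' (rel_ar (lang K) R)" "map e xs = map e' ys" "rint C R ys" by auto
    then show "rint C R (map ?h xs)" using uniq xs by blast
  next
    assume "rint C R (map ?h xs)"
    then have "(R, map e' (map ?h xs)) \<in> ?R" unfolding R using r ht[OF xs] by blast
    then have "(R, map e xs) \<in> ?R" unfolding mm[OF xs] .
    then obtain ys where ys: "ys \<in> tuples N (rel_ar (lang K) R)" "map e xs = map e ys" "rint C R ys" by auto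
    have "inj_on e (set xs \<union> set ys)"
      by (rule inj_on_subset[OF e(1)]) (use ys(1) xs in \<open>unfold tuples_def, blast\<close>)
    then have "xs = ys" using map_inj_on[OF ys(2)] by blast
    then show "rint C R xs" using ys(3) by blast
  qed
  have "is_struct (lang K) (sub N)" "is_struct (lang K) (sub N')"
    using submodel_substruct N unfolding substruct_def by blast+
  then show ?thesis unfolding is_iso_def using bij fh rh ht by (auto simp: restr_def)
qed

lemma submodel_univ: "submodel (univ C)"
  using leK_submodel C_leK by blast

text \<open>Put \<open>R\<close> and \<open>a\<close> into a model of size at most \<mu> and copy it
  into \<open>Field \<mu>\<close>. The copy, with the positions of \<open>a\<close> and of the
  elements of \<open>R\<close>, determines the type: equal copies give an isomorphism that fixes
  \<open>R\<close> and sends one element to the other, and homogeneity extends it. A copy is coded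
  by a subset of a set of size at most \<mu>.\<close>

lemma card_of_types:
  fixes \<mu> :: "'a rel"
  assumes LS: "LST_bound K LS" "LS \<le>o \<mu>" and \<mu>: "Cinfinite \<mu>" "\<mu> <o kbar"
    and R: "submodel R" "|R| \<le>o \<mu>"
  shows "|{tp1 K C a R |a. a \<in> univ C}| \<le>o ctwo ^c \<mu>"
proof -
  let ?X = "Field \<mu>" and ?F = "funs (lang K)" and ?L = "rels (lang K)"
  have X: "|?X| \<le>o \<mu>" "\<mu> \<le>o |?X|"
    using card_of_Field_ordIso \<mu>(1) ordIso_iff_ordLeq by blast+
  have "\<forall>a. \<exists>N e. a \<in> univ C \<longrightarrow> submodel N \<and> insert a R \<subseteq> N \<and> |N| \<le>o \<mu> \<and> inj_on e N \<and> e ` N \<subseteq> ?X"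
  proof
    fix a
    show "\<exists>N e. a \<in> univ C \<longrightarrow> submodel N \<and> insert a R \<subseteq> N \<and> |N| \<le>o \<mu> \<and> inj_on e N \<and> e ` N \<subseteq> ?X"
    proof (cases "a \<in> univ C")
      case True
      have "?X \<noteq> {}" using \<mu>(1) unfolding cinfinite_def by auto
      then have "|{a}| \<le>o \<mu>" by (rule Card_order_singl_ordLeq[OF conjunct2[OF \<mu>(1)]])
      then have "|{a} \<union> R| \<le>o \<mu>" using Un_Cinfinite_bound R(2) \<mu>(1) by blast
      then have "|insert a R| \<le>o \<mu>" by simp
      moreover have "insert a R \<subseteq> univ C" using True R(1) submodel_subset by blast
      ultimately obtain N where N: "submodel N" "insert a R \<subseteq> N" "|N| \<le>o \<mu>"
        using hull_exists[OF LS \<mu>(1) submodel_univ] by metis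
      then have "|N| \<le>o |?X|" using X(2) ordLeq_transitive by blast
      then show ?thesis using N card_of_ordLeq[of N ?X] by blast
    qed blast
  qed
  then obtain N e where Ne: "\<And>a. a \<in> univ C \<Longrightarrow> submodel (N a) \<and> insert a R \<subseteq> N a \<and> |N a| \<le>o \<mu> \<and> inj_on (e a) (N a) \<and> e a ` N a \<subseteq> ?X"
    by metis
  \<comment> \<open>\<open>c1\<close> and \<open>c2\<close> copy the functions and relations, and
    \<open>c3\<close> records where the elements of \<open>R\<close> go. In \<open>c\<close> the
    universe of the copy and the position of \<open>a\<close> are added, all in a disjoint sum, so
    that equal codes have equal components.\<close>
  define c1 where "c1 a = {(f, map (e a) xs, e a (fint C f xs)) |f xs. f \<in> ?F \<and> xs \<in> tuples (N a) (fun_ar (lang K) f)}" for a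
  define c2 where "c2 a = {(R, map (e a) xs) |R xs. R \<in> ?L \<and> xs \<in> tuples (N a) (rel_ar (lang K) R) \<and> rint C R xs}" for a
  define c3 where "c3 a = {(x, e a x) |x. x \<in> R}" for a
  define c where "c a = c1 a <+> c2 a <+> c3 a <+> e a ` N a <+> {e a a}" for a
  let ?T = "(?F \<times> lists ?X \<times> ?X) <+> (?L \<times> lists ?X) <+> (R \<times> ?X) <+> ?X <+> ?X"
  have lang: "|?F| \<le>o \<mu>" "|?L| \<le>o \<mu>"
  proof -
    have "|?F| +c |?L| \<le>o \<mu>" using LS ordLeq_transitive unfolding LST_bound_def by blast
    then show "|?F| \<le>o \<mu>" "|?L| \<le>o \<mu>"
      using ordLeq_csum1 ordLeq_csum2 card_of_Card_order ordLeq_transitive by blast+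
  qed
  have inf: "\<not> finite (Field \<mu>)" "Card_order \<mu>" using \<mu>(1) unfolding cinfinite_def by auto
  have T: "|?T| \<le>o \<mu>"
    by (intro card_of_Plus_ordLeq_infinite_Field card_of_Times_ordLeq_infinite_Field
        card_of_lists lang X R(2) \<mu>(1) inf)
  have cT: "c a \<in> Pow ?T" if a: "a \<in> univ C" for a
  proof -
    have cl: "fint C f xs \<in> N a" if "f \<in> ?F" "xs \<in> tuples (N a) (fun_ar (lang K) f)" for f xs
      using submodel_substruct Ne[OF a] substruct_restr_iff[OF C_struct] that by blast
    have eX: "e a x \<in> ?X" if "x \<in> N a" for x using Ne[OF a] that by blast
    have ml: "map (e a) xs \<in> lists ?X" if "xs \<in> tuples (N a) n" for xs n
      using that eX by (auto simp: tuples_def subset_iff)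
    have "c1 a \<subseteq> ?F \<times> lists ?X \<times> ?X"
    proof
      fix t assume "t \<in> c1 a"
      then obtain f xs where "t = (f, map (e a) xs, e a (fint C f xs))" "f \<in> ?F"
        "xs \<in> tuples (N a) (fun_ar (lang K) f)" unfolding c1_def by blast
      then show "t \<in> ?F \<times> lists ?X \<times> ?X" using cl ml eX by blast
    qed
    moreover have "c2 a \<subseteq> ?L \<times> lists ?X" unfolding c2_def using ml by blast
    moreover have "c3 a \<subseteq> R \<times> ?X" unfolding c3_def using Ne[OF a] by blast
    moreover have "e a ` N a \<subseteq> ?X" "{e a a} \<subseteq> ?X" using Ne[OF a] by blast+
    ultimately show ?thesis unfolding c_def by blast
  qed
  have eq: "tp1 K C a R = tp1 K C b R" if a: "a \<in> univ C" and b: "b \<in> univ C" and cab: "c a = c b" for a b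
  proof -
    have cc: "c1 a = c1 b" "c2 a = c2 b" "c3 a = c3 b" "e a ` N a = e b ` N b" "e a a = e b b"
      using cab unfolding c_def Plus_eq_iff by auto
    let ?h = "inv_into (N b) (e b) \<circ> e a"
    have iso: "is_iso (lang K) ?h (sub (N a)) (sub (N b))"
      using is_iso_of_codes[of "N a" "N b" "e a" "e b"] Ne[OF a] Ne[OF b] cc(1,2,4)
      unfolding c1_def c2_def by blast
    have "|N a| <o kbar" using Ne[OF a] \<mu>(2) ordLeq_ordLess_trans by blast
    then obtain g where g: "aut g" "\<forall>x\<in>N a. g x = ?h x"
      using aut_extend[OF _ _ _ iso] Ne[OF a] Ne[OF b] by blast
    have "e a x = e b x" if "x \<in> R" for x
    proof -
      have "(x, e a x) \<in> c3 a" using that by (simp add: c3_def)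
      then have "(x, e a x) \<in> c3 b" using cc(3) by simp
      then show ?thesis by (simp add: c3_def)
    qed
    then have "g x = x" if "x \<in> R" for x
      using g(2) that Ne[OF a] Ne[OF b] inv_into_f_f[of "e b" "N b" x] by (auto simp: subset_iff)
    moreover have "g a = b" using g(2) cc(5) Ne[OF a] Ne[OF b] inv_into_f_f[of "e b" "N b" b] by auto
    ultimately have "eqtp R a b" unfolding eqtp_def using g(1) by blast
    then show ?thesis using tp1_eq_iff a b submodel_subset[OF R(1)] by blast
  qed
  \<comment> \<open>As the code determines the type, one chosen element per code represents every
    type.\<close>
  have "{tp1 K C a R |a. a \<in> univ C} \<subseteq> (\<lambda>y. tp1 K C (SOME a. a \<in> univ C \<and> c a = y) R) ` Pow ?T"
  proof
    fix p assume "p \<in> {tp1 K C a R |a. a \<in> univ C}"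
    then obtain a where a: "a \<in> univ C" "p = tp1 K C a R" by blast
    let ?b = "SOME b. b \<in> univ C \<and> c b = c a"
    have "?b \<in> univ C \<and> c ?b = c a"
      using someI[of "\<lambda>b. b \<in> univ C \<and> c b = c a" a] a(1) by simp
    then have "p = tp1 K C ?b R" using eq[of ?b a] a by simp
    then show "p \<in> (\<lambda>y. tp1 K C (SOME a. a \<in> univ C \<and> c a = y) R) ` Pow ?T"
      by (rule image_eqI) (rule cT[OF a(1)])
  qed
  then have "|{tp1 K C a R |a. a \<in> univ C}| \<le>o |Pow ?T|" by (rule surj_imp_ordLeq)
  also have "|Pow ?T| =o ctwo ^c |?T|"
    using card_of_Pow_Func[of ?T] by (simp add: cexp_def ctwo_def Field_card_of)
  also have "ctwo ^c |?T| \<le>o ctwo ^c \<mu>"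
  proof (rule cexp_mono2'[OF T Card_order_ctwo])
    have "?X \<noteq> {}" using inf(1) by auto
    then show "Field |?T| = {} \<Longrightarrow> Field \<mu> = {}" by (auto simp: Field_card_of)
  qed
  finally show ?thesis .
qed

end

section \<open>Nonforking for elements\<close>

locale simple_independence = monster_model K kbar C
  for K :: "('f, 'r, 'a) aec" and kbar :: "'a rel" and C :: "('f, 'r, 'a) struct" +
  fixes ind :: "('f, 'r, 'a) indrel"
  assumes simple: "simple_independence_relation K kbar C ind"
    and fin_witness: "finite_witness_singletons K kbar C ind"
begin

abbreviation small :: "'a set \<Rightarrow> bool" where
  "small A \<equiv> small_set kbar C A"

abbreviation indep :: "'a set \<Rightarrow> 'a set \<Rightarrow> 'a set \<Rightarrow> bool" where
  "indep A R B \<equiv> ind A (sub R) B"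

lemma small_model_sub: "submodel R \<Longrightarrow> small R \<Longrightarrow> small_model K kbar C (sub R)"
  unfolding small_model_def small_set_def submodel_def by simp

lemma small_subset: "small A \<Longrightarrow> B \<subseteq> A \<Longrightarrow> small B"
  unfolding small_set_def using card_of_mono1 ordLeq_ordLess_trans by blast

lemma kbar_Cinfinite: "Cinfinite kbar"
  using mon unfolding monster_def strong_limit_def by blast

lemma small_singleton: "a \<in> univ C \<Longrightarrow> small {a}"
  using kbar_Cinfinite finite_iff_ordLess_natLeq[of "{a}"] natLeq_ordLeq_cinfinite ordLess_ordLeq_trans
  unfolding small_set_def by blast

lemma small_Un: "small A \<Longrightarrow> small B \<Longrightarrow> small (A \<union> B)"
  unfolding small_set_def using Un_Cinfinite_bound_strict kbar_Cinfinite by blast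

lemma simple_rules:
  "ind_invariance K kbar C ind" "ind_monotonicity K kbar C ind" "ind_normality K kbar C ind"
  "ind_base_monotonicity K kbar C ind" "ind_existence K kbar C ind" "ind_transitivity K kbar C ind"
  "type_amalgamation K kbar C ind"
  using simple unfolding simple_independence_relation_def independence_relation_def by blast+

lemma indep_invariant:
  assumes g: "aut g" "\<And>x. x \<in> R \<Longrightarrow> g x = x" and R: "submodel R" "small R"
    and AB: "small A" "small B" "indep A R B"
  shows "indep (g ` A) R (g ` B)"
proof -
  have "g ` R = R" using g(2) by force
  then have "is_iso (lang K) g (sub R) (sub R)" using aut_image(1)[OF g(1) R(1)] by simp
  then show ?thesis
    using simple_rules(1)[unfolded ind_invariance_def, rule_format, of g "sub R" "sub R" A B]
      small_model_sub[OF R] AB g(1) by blast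
qed

lemma indep_mono:
  assumes "submodel R" "small R" "small A" "small B" "indep A R B" "A' \<subseteq> A" "B' \<subseteq> B"
  shows "indep A' R B'"
  using simple_rules(2)[unfolded ind_monotonicity_def, rule_format, of "sub R" A B A' B']
    small_model_sub assms by blast

lemma indep_normal:
  assumes "submodel R" "small R" "small A" "small B" "indep A R B"
  shows "indep (A \<union> R) R (B \<union> R)"
  using simple_rules(3)[unfolded ind_normality_def, rule_format, of "sub R" A B]
    small_model_sub assms by simp

lemma indep_base_mono:
  assumes "submodel M" "submodel N" "small B" "small A" "indep A M B" "M \<subseteq> N" "N \<subseteq> B"
  shows "indep A N B"
proof -
  have "small N" "small M" using assms small_subset by blast+
  then show ?thesis
    using simple_rules(4)[unfolded ind_base_monotonicity_def, rule_format, of "sub M" "sub N" A B]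
      small_model_sub submodel_leK assms by simp
qed

lemma indep_trans:
  assumes "submodel M" "submodel N" "small N" "small A" "small B" "M \<subseteq> N" "indep A M N" "indep A N B"
  shows "indep A M B"
proof -
  have "small M" using assms small_subset by blast
  then show ?thesis
    using simple_rules(6)[unfolded ind_transitivity_def, rule_format, of "sub M" "sub N" A B]
      small_model_sub submodel_leK assms by simp
qed

lemma indep_eqtp:
  assumes "submodel R" "R \<subseteq> B" "small B" "a \<in> univ C" "indep {a} R B" "eqtp B a a'"
  shows "indep {a'} R B"
proof -
  obtain g where g: "aut g" "\<forall>x\<in>B. g x = x" "g a = a'" using assms(6) unfolding eqtp_def by blast
  have "indep (g ` {a}) R (g ` B)"
    using indep_invariant[OF g(1) _ assms(1)] g(2) assms small_subset[OF assms(3,2)] small_singleton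
    by blast
  moreover have "g ` B = B" using g(2) by force
  ultimately show ?thesis using g(3) by simp
qed

section \<open>The axioms for types of single elements\<close>

lemma small_length_card_of: "small A \<Longrightarrow> small_length kbar |A|"
  unfolding small_length_def small_set_def by (simp add: card_of_well_order_on Field_card_of)

text \<open>Nonforking asks for some independent realization of the type; any other one is conjugate
  to it over \<open>B\<close>, and independence is invariant. The axioms index sequences by
  well-orders on the type of elements, so an arbitrary \<open>x\<close> of that type serves as the
  only index of a sequence of length one.\<close>

lemma does_not_fork_iff:
  fixes x :: 'a
  assumes a: "a \<in> univ C" and R: "submodel R" "R \<subseteq> B" "small B"
  shows "does_not_fork K C ind |{x}| (gtp K C {x} (\<lambda>_. a) B) (sub R) \<longleftrightarrow> indep {a} R B"
proof
  assume "does_not_fork K C ind |{x}| (gtp K C {x} (\<lambda>_. a) B) (sub R)"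
  then obtain b where b: "b \<in> {x} \<rightarrow> univ C" "gtp K C {x} (\<lambda>_. a) B = gtp K C {x} b B" "indep (b ` {x}) R B"
    unfolding does_not_fork_def by (auto simp: Field_card_of)
  have BC: "B \<subseteq> univ C" using R(3) unfolding small_set_def by blast
  obtain g where "aut g" "\<forall>y\<in>B. g y = y" "g a = b x"
    using b(2) gtp_eq_iff[of "\<lambda>_. a" "{x}" b B] a b(1) BC by auto
  then have "eqtp B a (b x)" unfolding eqtp_def by blast
  then have "eqtp B (b x) a" using eqtp_sym BC a by blast
  then show "indep {a} R B" using indep_eqtp[OF R, of "b x" a] b by auto
next
  assume "indep {a} R B"
  then show "does_not_fork K C ind |{x}| (gtp K C {x} (\<lambda>_. a) B) (sub R)"
    unfolding does_not_fork_def using a by (auto simp: Field_card_of intro!: bexI[of _ "\<lambda>_. a"])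
qed

lemma gS_singleton:
  fixes x :: 'a
  shows "gS K C |{x}| A = {gtp K C {x} (\<lambda>_. a) A |a. a \<in> univ C}"
proof -
  have "restrict (g \<circ> b) {x} = restrict (g \<circ> (\<lambda>_. b x)) {x}" for g b :: "'a \<Rightarrow> 'a" by auto
  then have "gtp K C {x} b A = gtp K C {x} (\<lambda>_. b x) A" for b unfolding gtp_def by (simp only:)
  then have "\<exists>a. gtp K C {x} b A = gtp K C {x} (\<lambda>_. a) A \<and> a \<in> univ C" if "b x \<in> univ C" for b
    using that by blast
  then show ?thesis unfolding gS_def by (force simp: Field_card_of)
qed

lemma extends_singleton_iff:
  fixes x :: 'a
  assumes "a \<in> univ C" "b \<in> univ C" "A \<subseteq> B" "A \<subseteq> univ C"
  shows "extends (gtp K C {x} (\<lambda>_. a) B) (gtp K C {x} (\<lambda>_. b) A) \<longleftrightarrow> eqtp A a b"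
  using extends_gtp_iff[of "\<lambda>_. a" "{x}" "\<lambda>_. b" A B] assms unfolding eqtp_def by auto

lemma small_length_singleton: "small_length kbar |{x :: 'a}|"
proof -
  have "|{x}| <o natLeq" using finite_iff_ordLess_natLeq[of "{x}"] by blast
  then have "|{x}| <o kbar"
    using kbar_Cinfinite natLeq_ordLeq_cinfinite ordLess_ordLeq_trans by blast
  then show ?thesis unfolding small_length_def by (simp add: card_of_well_order_on Field_card_of)
qed

lemma nonforking_extension:
  assumes "a \<in> univ C" "submodel M" "submodel N" "small N" "M \<subseteq> N"
  shows "\<exists>a'\<in>univ C. eqtp M a' a \<and> indep {a'} M N"
proof -
  fix x :: 'a
  have M: "small M" "M \<subseteq> univ C" using assms small_subset unfolding small_set_def by blast+
  have "gtp K C {x} (\<lambda>_. a) M \<in> gS K C |{x}| (univ (sub M))" using gS_singleton assms(1) by auto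
  then obtain q where q: "q \<in> gS K C |{x}| (univ (sub N))" "extends q (gtp K C {x} (\<lambda>_. a) M)"
      "does_not_fork K C ind |{x}| q (sub M)"
    using simple_rules(5)[unfolded ind_existence_def, rule_format, of _ "|{x}|" "sub M" "sub N"]
      small_model_sub submodel_leK assms M small_length_singleton by blast
  then obtain a' where a': "a' \<in> univ C" "q = gtp K C {x} (\<lambda>_. a') N" using gS_singleton by auto
  then show ?thesis
    using q extends_singleton_iff[OF a'(1) assms(1,5) M(2)] does_not_fork_iff[OF a'(1) assms(2,5,4)]
    by auto
qed

text \<open>Type amalgamation for length one, with the type of \<open>b\<close> over
  \<open>R\<close> as the common restriction; \<open>c\<close> realizes the amalgam over
  \<open>N\<close>.\<close>

lemma amalgamate_types:
  assumes R: "submodel R" "R \<subseteq> A" "R \<subseteq> B" and N: "submodel N" "small N" "A \<union> B \<subseteq> N"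
    and AB: "indep A R B" and a: "a \<in> univ C" "indep {a} R A" and b: "b \<in> univ C" "indep {b} R B"
    and ab: "eqtp R a b"
  shows "\<exists>c\<in>univ C. eqtp A c a \<and> eqtp B c b \<and> indep {c} R N"
proof -
  fix x :: 'a
  let ?t = "\<lambda>a. gtp K C {x} (\<lambda>_. a)"
  have sm: "small A" "small B" "small R" using R N small_subset[of N] by blast+
  have sC: "A \<subseteq> univ C" "B \<subseteq> univ C" "R \<subseteq> univ C" using sm unfolding small_set_def by blast+
  have mem: "?t b R \<in> gS K C |{x}| (univ (sub R))" "?t a A \<in> gS K C |{x}| A" "?t b B \<in> gS K C |{x}| B"
    using gS_singleton a b by auto
  have ext: "extends (?t a A) (?t b R)" "extends (?t b B) (?t b R)"
    using extends_singleton_iff[OF a(1) b(1) R(2) sC(3)] extends_singleton_iff[OF b(1) b(1) R(3) sC(3)]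
      ab eqtp_refl by auto
  have dnf: "does_not_fork K C ind |{x}| (?t a A) (sub R)" "does_not_fork K C ind |{x}| (?t b B) (sub R)"
    using does_not_fork_iff[OF a(1) R(1,2) sm(1)] does_not_fork_iff[OF b(1) R(1,3) sm(2)] a(2) b(2) by auto
  obtain q where q: "q \<in> gS K C |{x}| (univ (sub N))" "extends q (?t a A)" "extends q (?t b B)"
      "does_not_fork K C ind |{x}| q (sub R)"
    using simple_rules(7)[unfolded type_amalgamation_def, rule_format, OF mem, of "sub N"]
      small_length_singleton small_model_sub[OF R(1) sm(3)] small_model_sub[OF N(1,2)] sm(1,2) R(2,3) AB N(3)
      ext dnf by auto
  then obtain c where c: "c \<in> univ C" "q = ?t c N" using gS_singleton by auto
  have "A \<subseteq> N" "B \<subseteq> N" "R \<subseteq> N" using N(3) R(2) by blast+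
  then show ?thesis
    using q c extends_singleton_iff[OF c(1) a(1), of A N] extends_singleton_iff[OF c(1) b(1), of B N]
      does_not_fork_iff[OF c(1) R(1) _ N(2)] sC by auto
qed

text \<open>Existence for \<open>R\<close> over itself gives an independent element of the same type
  over \<open>R\<close>, and independence depends on the type only.\<close>

lemma indep_self:
  assumes "a \<in> univ C" "submodel R" "small R" shows "indep {a} R R"
proof -
  obtain a' where "a' \<in> univ C" "eqtp R a' a" "indep {a'} R R"
    using nonforking_extension[OF assms(1,2,2,3)] by blast
  then show ?thesis using indep_eqtp assms by blast
qed

section \<open>Local character for elements and for sets\<close>

lemma local_characterD:
  assumes "local_character_pair K kbar C ind kap ell" "p \<in> gS K C \<alpha> (univ M)"
    "small_length kbar \<alpha>" "small_model K kbar C M"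
  shows "\<exists>M\<^sub>0. leK K M\<^sub>0 M \<and> |univ M\<^sub>0| \<le>o kap +c cexp_less |Field \<alpha>| ell \<and>
    does_not_fork K C ind \<alpha> p M\<^sub>0"
  using assms(1)[unfolded local_character_pair_def, THEN conjunct2, THEN conjunct2, THEN conjunct2,
      THEN conjunct2, rule_format, OF assms(2) conjI[OF assms(3,4)]] .

lemma local_character_element:
  assumes lc: "local_character_pair K kbar C ind kap ell"
    and a: "a \<in> univ C" and N: "submodel N" "small N"
  shows "\<exists>M\<subseteq>N. submodel M \<and> |M| \<le>o kap +c cone \<and> indep {a} M N"
proof -
  fix x :: 'a
  have "gtp K C {x} (\<lambda>_. a) N \<in> gS K C |{x}| (univ (sub N))" using gS_singleton a by auto
  then obtain M where M: "leK K M (sub N)" "|univ M| \<le>o kap +c cexp_less |Field |{x}|| ell"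
      "does_not_fork K C ind |{x}| (gtp K C {x} (\<lambda>_. a) N) M"
    using local_characterD[OF lc _ small_length_singleton small_model_sub[OF N]] by blast
  have MC: "leK K M C" using M(1) N(1) leK_trans unfolding submodel_def by blast
  have MN: "univ M \<subseteq> N" using leK_substruct[OF M(1)] unfolding substruct_def by simp
  have "kap +c cexp_less |{x}| ell \<le>o kap +c cone" by (rule csum_mono2[OF cexp_less_singleton])
  then have "|univ M| \<le>o kap +c cone" using M(2) ordLeq_transitive by (auto simp: Field_card_of)
  moreover have "indep {a} (univ M) N"
    using does_not_fork_iff[OF a leK_submodel[OF MC] MN N(2)] M(3) leK_sub_eq[OF MC] by auto
  ultimately show ?thesis using MN leK_submodel[OF MC] by blast
qed

text \<open>Apply local character to the type of \<open>N\<close> enumerated by the identity, a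
  sequence of length at most \<mu>. The condition on \<open>cexp_less \<mu> ell\<close> keeps the
  base at size at most \<mu>.\<close>

lemma local_character_set:
  fixes \<mu> :: "'a rel"
  assumes lc: "local_character_pair K kbar C ind kap ell"
    and \<mu>: "Cinfinite \<mu>" "kap \<le>o \<mu>" "cexp_less \<mu> ell =o \<mu>"
    and N: "small N" "|N| \<le>o \<mu>" and W: "submodel W" "small W"
  shows "\<exists>R\<subseteq>W. submodel R \<and> |R| \<le>o \<mu> \<and> indep N R W"
proof -
  have NC: "N \<subseteq> univ C" and WC: "W \<subseteq> univ C" using N W unfolding small_set_def by blast+
  have "gtp K C N id W \<in> gS K C |N| (univ (sub W))"
    unfolding gS_def using NC by (auto simp: Field_card_of intro!: exI[of _ id])
  then obtain M where M: "leK K M (sub W)" "|univ M| \<le>o kap +c cexp_less |Field |N|| ell"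
      "does_not_fork K C ind |N| (gtp K C N id W) M"
    using local_characterD[OF lc _ small_length_card_of[OF N(1)] small_model_sub[OF W]] by blast
  have MC: "leK K M C" using M(1) W(1) leK_trans unfolding submodel_def by blast
  have MW: "univ M \<subseteq> W" using leK_substruct[OF M(1)] unfolding substruct_def by simp
  have "cexp_less |N| ell \<le>o \<mu>"
    using cexp_less_mono1[OF card_of_Card_order _ N(2), of ell] \<mu> ordLeq_ordIso_trans by blast
  moreover have "Card_order (cexp_less |N| ell)"
    using is_card_sup_card_sup[of "{|N| ^c s |s :: 'a rel. Card_order s \<and> s <o ell}"] Card_order_cexp
    unfolding cexp_less_def is_card_sup_def by fastforce
  moreover have "Card_order kap" using lc unfolding local_character_pair_def by blast
  ultimately have "kap +c cexp_less |N| ell \<le>o \<mu>" using csum_cinfinite_bound \<mu> by blast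
  then have card: "|univ M| \<le>o \<mu>" using M(2) ordLeq_transitive by (auto simp: Field_card_of)
  obtain b where b: "b \<in> N \<rightarrow> univ C" "gtp K C N id W = gtp K C N b W" "ind (b ` N) M W"
    using M(3) unfolding does_not_fork_def by (auto simp: Field_card_of)
  have "gtp K C N b W = gtp K C N id W" using b(2) by simp
  \<comment> \<open>The independent realization \<open>b\<close> may differ from the enumeration of
    \<open>N\<close>. An automorphism fixing \<open>W\<close>, and with it the base, moves it
    there.\<close>
  then obtain g where g: "aut g" "\<forall>x\<in>W. g x = x" "\<forall>i\<in>N. g (b i) = i"
    using gtp_eq_iff[of b N id W] b(1) NC WC by (auto simp: Pi_iff subset_iff)
  have "g ` b ` N = N" "g ` W = W" using g by force+
  moreover have "small (b ` N)"
    using b(1) N(1) card_of_image[of b N] ordLeq_ordLess_trans unfolding small_set_def by blast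
  moreover have "indep (b ` N) (univ M) W" using b(3) leK_sub_eq[OF MC] by simp
  ultimately have "indep N (univ M) W"
    using indep_invariant[OF g(1) _ leK_submodel[OF MC] small_subset[OF W(2) MW], of "b ` N" W] g(2) MW W(2)
    by (auto simp: subset_iff)
  then show ?thesis using MW card leK_submodel[OF MC] by blast
qed

end

section \<open>Maximal sets of simultaneously realized types\<close>

text \<open>The first component has to grow strictly: the length of a chain is then bounded by the number
  of types collected along it, which bounds the size of the union of the models.\<close>

definition pair_le :: "'b set \<times> 'c set \<Rightarrow> 'b set \<times> 'c set \<Rightarrow> bool" where
  "pair_le x y \<longleftrightarrow> x = y \<or> fst x \<subset> fst y \<and> snd x \<subseteq> snd y"

lemma pair_le_subset: "pair_le x y \<Longrightarrow> fst x \<subseteq> fst y \<and> snd x \<subseteq> snd y"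
  unfolding pair_le_def by blast

lemma partial_order_pair_le: "partial_order_on A (relation_of pair_le A)"
  by (rule partial_order_on_relation_ofI) (auto simp: pair_le_def)

text \<open>\<open>G\<close> is what pigeonhole leaves: types over models of size at most \<mu>,
  nonforking over the same \<open>M\<^sub>0\<close>, of which at most \<open>ctwo ^c \<mu>\<close>
  are ever realized together. The bound by \<open>kbar\<close> keeps unions of models small until a
  sharper bound is available.\<close>

locale type_family = simple_independence K kbar C ind
  for K :: "('f, 'r, 'a) aec" and kbar :: "'a rel" and C :: "('f, 'r, 'a) struct"
    and ind :: "('f, 'r, 'a) indrel" +
  fixes \<mu> LS :: "'a rel" and M\<^sub>0 :: "'a set" and G :: "(unit, 'a) gtype set"
  assumes LS: "LST_bound K LS" "LS \<le>o \<mu>" and \<mu>: "Cinfinite \<mu>" "\<mu> <o kbar"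
    and G_types: "\<And>p. p \<in> G \<Longrightarrow> \<exists>a N. a \<in> univ C \<and> submodel N \<and> |N| \<le>o \<mu> \<and> M\<^sub>0 \<subseteq> N \<and>
      p = tp1 K C a N \<and> indep {a} M\<^sub>0 N"
    and M\<^sub>0: "submodel M\<^sub>0"
    and G_small: "|G| <o kbar"
    and G_consistent: "\<And>\<Delta>. \<Delta> \<subseteq> G \<Longrightarrow> consistent K C \<Delta> \<Longrightarrow> |\<Delta>| \<le>o ctwo ^c \<mu>"
begin

abbreviation \<chi> :: "('a \<Rightarrow> bool) rel" where "\<chi> \<equiv> ctwo ^c \<mu>"

lemma \<chi>_Cinfinite: "Cinfinite \<chi>"
  using Cinfinite_cexp \<mu> ordLeq_refl Card_order_ctwo by blast

lemma \<mu>_le_\<chi>: "\<mu> \<le>o \<chi>"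
  using ordLess_ctwo_cexp \<mu>(1) ordLess_imp_ordLeq by blast

lemma LS_le_\<chi>: "LS \<le>o \<chi>"
  using LS(2) \<mu>_le_\<chi> ordLeq_transitive by blast

lemma \<chi>_less_kbar: "\<chi> <o kbar"
  using mon \<mu> unfolding monster_def strong_limit_def by blast

lemma small_if_le_\<chi>: "A \<subseteq> univ C \<Longrightarrow> |A| \<le>o \<chi> \<Longrightarrow> small A"
  unfolding small_set_def using \<chi>_less_kbar ordLeq_ordLess_trans by blast

lemma small_if_le_\<mu>: "A \<subseteq> univ C \<Longrightarrow> |A| \<le>o \<mu> \<Longrightarrow> small A"
  using small_if_le_\<chi> \<mu>_le_\<chi> ordLeq_transitive by blast

text \<open>\<open>H\<close> is the graph of a strong embedding, fixing \<open>R\<close>, of a model into the monster model. Keeping the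
  realization \<open>b\<close> fixed and moving the models instead makes the types that \<open>b\<close> realizes, pulled back
  along the embeddings, a coherent family: this is what makes unions of chains possible.\<close>

definition partial_solution :: "'a set \<Rightarrow> 'a \<Rightarrow> (unit, 'a) gtype set \<times> ('a \<times> 'a) set \<Rightarrow> bool" where
  "partial_solution R b x \<longleftrightarrow> fst x \<subseteq> G \<and> submodel (Domain (snd x)) \<and> |Domain (snd x)| \<le>o \<chi> \<and>
     (\<forall>y\<in>R. (y, y) \<in> snd x) \<and>
     (\<exists>g a. aut g \<and> (\<forall>(y, z)\<in>snd x. g y = z) \<and> a \<in> univ C \<and> g a = b \<and> indep {a} R (Domain (snd x)) \<and>
        (\<forall>p\<in>fst x. fst p \<subseteq> Domain (snd x) \<and> realizes K C a p))"

section \<open>Unions of chains of partial solutions, and maximality\<close>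

lemma partial_solutionD:
  assumes "partial_solution R b x"
  shows "fst x \<subseteq> G" "submodel (Domain (snd x))" "|Domain (snd x)| \<le>o \<chi>" "small (Domain (snd x))"
    "R \<subseteq> Domain (snd x)" "\<forall>y\<in>R. (y, y) \<in> snd x"
    "\<exists>g a. aut g \<and> (\<forall>(y, z)\<in>snd x. g y = z) \<and> a \<in> univ C \<and> g a = b \<and> indep {a} R (Domain (snd x)) \<and>
        (\<forall>p\<in>fst x. fst p \<subseteq> Domain (snd x) \<and> realizes K C a p)"
proof -
  note sol = assms[unfolded partial_solution_def]
  show "fst x \<subseteq> G" "submodel (Domain (snd x))" "|Domain (snd x)| \<le>o \<chi>" "\<forall>y\<in>R. (y, y) \<in> snd x"
    using sol by simp_all
  then show "small (Domain (snd x))" "R \<subseteq> Domain (snd x)"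
    using small_if_le_\<chi> submodel_subset by blast+
  show "\<exists>g a. aut g \<and> (\<forall>(y, z)\<in>snd x. g y = z) \<and> a \<in> univ C \<and> g a = b \<and> indep {a} R (Domain (snd x)) \<and>
        (\<forall>p\<in>fst x. fst p \<subseteq> Domain (snd x) \<and> realizes K C a p)"
    using sol by simp
qed

lemma realizes_eqtp:
  assumes "realizes K C a p" "eqtp B a a'" "fst p \<subseteq> B" "B \<subseteq> univ C" "a \<in> univ C"
  shows "realizes K C a' p"
  using assms tp1_eq_iff[of a a' "fst p"] eqtp_mono eqtp_in unfolding realizes_def
  by (metis order_trans)

lemma partial_solution_consistent:
  assumes "partial_solution R b x"
  shows "|fst x| \<le>o \<chi>"
proof -
  obtain a where "a \<in> univ C" "\<forall>p\<in>fst x. fst p \<subseteq> Domain (snd x) \<and> realizes K C a p"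
    using partial_solutionD(7)[OF assms] by blast
  then have "consistent K C (fst x)" unfolding consistent_def by blast
  then show ?thesis using G_consistent partial_solutionD(1)[OF assms] by blast
qed

lemma partial_solution_init:
  assumes R: "submodel R" "|R| \<le>o \<mu>" and b: "b \<in> univ C"
  shows "partial_solution R b ({}, Id_on R)"
proof -
  have "small R" using small_if_le_\<mu> R submodel_subset by blast
  then have "indep {b} R R" using indep_self b R(1) by blast
  moreover have "|R| \<le>o \<chi>" using R(2) \<mu>_le_\<chi> ordLeq_transitive by blast
  ultimately show ?thesis
    unfolding partial_solution_def using R(1) b aut_id
    by (auto intro!: exI[of _ id] exI[of _ b])
qed

text \<open>Without a largest member, take unions in both components. The graphs glue to an
  automorphism, along which \<open>b\<close> is pulled back to an element that realizes all
  collected types and is independent by the finite witness property.\<close>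

lemma partial_solution_chain:
  assumes R: "submodel R" and ne: "\<X> \<noteq> {}" and sol: "\<And>x. x \<in> \<X> \<Longrightarrow> partial_solution R b x"
    and chain: "\<And>x y. x \<in> \<X> \<Longrightarrow> y \<in> \<X> \<Longrightarrow> pair_le x y \<or> pair_le y x"
  shows "\<exists>u. partial_solution R b u \<and> (\<forall>x\<in>\<X>. pair_le x u)"
proof (cases "\<exists>m\<in>\<X>. \<forall>x\<in>\<X>. pair_le x m")
  case True
  then show ?thesis using sol by blast
next
  case False
  let ?D = "\<Union>(fst ` \<X>)" and ?H = "\<Union>(snd ` \<X>)"
  let ?P = "Domain ?H"
  have bigger: "\<exists>y\<in>\<X>. fst x \<subset> fst y" if x: "x \<in> \<X>" for x
  proof -
    obtain y where y: "y \<in> \<X>" "\<not> pair_le y x" using False x by blast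
    then have "pair_le x y" "x \<noteq> y" using chain[OF x y(1)] by (auto simp: pair_le_def)
    then show ?thesis using y(1) unfolding pair_le_def by blast
  qed
  \<comment> \<open>\<open>X p\<close> is a member of the chain that has collected \<open>p\<close>.
    Every \<open>x\<close> is followed by a member with a new type \<open>p\<close>, and then
    \<open>X p\<close> lies above \<open>x\<close>; so the domains at the chosen members cover the
    union.\<close>
  have "\<forall>p. \<exists>x. p \<in> ?D \<longrightarrow> x \<in> \<X> \<and> p \<in> fst x" by blast
  then obtain X where X: "\<And>p. p \<in> ?D \<Longrightarrow> X p \<in> \<X> \<and> p \<in> fst (X p)" by metis
  have cover: "?P \<subseteq> (\<Union>p\<in>?D. Domain (snd (X p)))"
  proof
    fix z assume "z \<in> ?P"
    then obtain x where x: "x \<in> \<X>" "z \<in> Domain (snd x)" by blast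
    obtain y p where y: "y \<in> \<X>" "p \<in> fst y" "p \<notin> fst x" using bigger[OF x(1)] by blast
    then have p: "p \<in> ?D" by blast
    have "\<not> pair_le (X p) x" using X[OF p] y(3) pair_le_subset by blast
    then have "snd x \<subseteq> snd (X p)" using chain x(1) X[OF p] pair_le_subset by blast
    then show "z \<in> (\<Union>p\<in>?D. Domain (snd (X p)))" using p x(2) by blast
  qed
  have cardX: "|Domain (snd (X p))| \<le>o \<chi>" if "p \<in> ?D" for p
    using partial_solutionD(3)[OF sol] X[OF that] by blast
  have DG: "?D \<subseteq> G" using partial_solutionD(1)[OF sol] by blast
  \<comment> \<open>This provisional bound is below \<open>kbar\<close>, which is enough for gluing.
    The bound \<chi> comes only after the collected types are known to be consistent.\<close>
  let ?r = "|G| +c \<chi>"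
  have r: "Cinfinite ?r" using Cinfinite_csum \<chi>_Cinfinite by blast
  have le_r: "|?D| \<le>o ?r" "\<chi> \<le>o ?r"
    using card_of_mono1[OF DG] ordLeq_csum1[OF card_of_Card_order] ordLeq_csum2 Card_order_cexp
      ordLeq_transitive by blast+
  have "|\<Union>p\<in>?D. Domain (snd (X p))| \<le>o ?r"
    using UNION_Cinfinite_bound[of ?D ?r "\<lambda>p. Domain (snd (X p))"] le_r cardX ordLeq_transitive r by blast
  then have "|?P| \<le>o ?r" using card_of_mono1[OF cover] ordLeq_transitive by blast
  moreover have "?r <o kbar"
  proof -
    have "|Field \<chi>| <o kbar"
      using \<chi>_less_kbar card_of_Field_ordIso[OF Card_order_cexp] ordIso_ordLess_trans by blast
    then have "|G <+> Field \<chi>| <o kbar"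
      using card_of_Plus_ordLess_infinite_Field G_small kbar_Cinfinite unfolding cinfinite_def by blast
    then show ?thesis unfolding csum_def by (simp add: Field_card_of)
  qed
  ultimately have smallP: "|?P| <o kbar" using ordLeq_ordLess_trans by blast
  have glue: "\<exists>g. aut g \<and> (\<forall>(y, z)\<in>?H. g y = z) \<and> submodel ?P"
  proof -
    have 1: "snd ` \<X> \<noteq> {}" using ne by blast
    have 2: "H \<subseteq> H' \<or> H' \<subseteq> H" if "H \<in> snd ` \<X>" "H' \<in> snd ` \<X>" for H H'
    proof -
      obtain x y where xy: "x \<in> \<X>" "y \<in> \<X>" "H = snd x" "H' = snd y"
        using \<open>H \<in> snd ` \<X>\<close> \<open>H' \<in> snd ` \<X>\<close> by blast
      then show ?thesis using chain[OF xy(1,2)] pair_le_subset by blast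
    qed
    have 3: "submodel (Domain H) \<and> (\<exists>g. aut g \<and> (\<forall>(y, z)\<in>H. g y = z))" if "H \<in> snd ` \<X>" for H
      using that partial_solutionD(2,7)[OF sol] by blast
    show ?thesis using aut_glue[OF 1 2 3 smallP] by blast
  qed
  then obtain g where g: "aut g" "\<forall>(y, z)\<in>?H. g y = z" and P: "submodel ?P" by blast
  have sP: "small ?P" unfolding small_set_def using P submodel_subset smallP by blast
  have bC: "b \<in> univ C"
    using partial_solutionD(7)[OF sol] ne aut_in by blast
  obtain h where h: "aut h" "\<forall>x\<in>univ C. h (g x) = x \<and> g (h x) = x" using aut_inverse[OF g(1)] by blast
  let ?a = "h b"
  have a: "?a \<in> univ C" "g ?a = b" using h aut_in bC by blast+
  have each: "indep {?a} R (Domain (snd x)) \<and> (\<forall>p\<in>fst x. fst p \<subseteq> Domain (snd x) \<and> realizes K C ?a p) \<and>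
      R \<subseteq> Domain (snd x)"
    if x: "x \<in> \<X>" for x
  proof -
    note D = partial_solutionD[OF sol[OF x]]
    obtain gx ax where X: "aut gx" "\<forall>(y, z)\<in>snd x. gx y = z" "ax \<in> univ C" "gx ax = b"
      "indep {ax} R (Domain (snd x))" "\<forall>p\<in>fst x. fst p \<subseteq> Domain (snd x) \<and> realizes K C ax p"
      using D(7) by blast
    have "h (gx y) = y" if "y \<in> Domain (snd x)" for y
    proof -
      obtain z where z: "(y, z) \<in> snd x" using \<open>y \<in> Domain (snd x)\<close> by blast
      have zH: "(y, z) \<in> ?H" using z x by blast
      have "gx y = z" "g y = z" using bspec[OF X(2) z] bspec[OF g(2) zH] by simp_all
      moreover have "y \<in> univ C" using \<open>y \<in> Domain (snd x)\<close> submodel_subset[OF D(2)] by blast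
      ultimately show ?thesis using h(2) by metis
    qed
    \<comment> \<open>Both \<open>gx\<close> and \<open>g\<close> extend the graph of
      \<open>x\<close>, so \<open>gx\<close> followed by the inverse of \<open>g\<close> fixes its
      domain and carries \<open>ax\<close> to \<open>?a\<close>.\<close>
    then have "eqtp (Domain (snd x)) ax ?a"
      unfolding eqtp_def using is_iso_comp[OF X(1) h(1)] X(4) by (intro exI[of _ "h \<circ> gx"]) auto
    then show ?thesis
      using indep_eqtp[OF R D(5,4) X(3,5)] X(6) realizes_eqtp[OF _ _ _ submodel_subset[OF D(2)] X(3)] D(5) by blast
  qed
  have DP: "Domain (snd x) \<subseteq> ?P" if "x \<in> \<X>" for x using that by blast
  obtain x\<^sub>0 where x\<^sub>0: "x\<^sub>0 \<in> \<X>" using ne by blast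
  have RP: "R \<subseteq> ?P" using each[OF x\<^sub>0] DP[OF x\<^sub>0] by blast
  \<comment> \<open>A finite part of the union lies in one domain of the chain, where independence
    is known.\<close>
  have "indep {?a} R A" if A: "finite A" "A \<subseteq> ?P" for A
  proof -
    have "\<exists>x\<in>\<X>. A \<subseteq> Domain (snd x)" using A
    proof (induction rule: finite_induct)
      case empty then show ?case using ne by blast
    next
      case (insert z F)
      then obtain x y where xy: "x \<in> \<X>" "F \<subseteq> Domain (snd x)" "y \<in> \<X>" "z \<in> Domain (snd y)" by blast
      have "snd x \<subseteq> snd y \<or> snd y \<subseteq> snd x" using chain[OF xy(1,3)] pair_le_subset by blast
      then have "Domain (snd x) \<subseteq> Domain (snd y) \<or> Domain (snd y) \<subseteq> Domain (snd x)" using Domain_mono by blast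
      then show ?case
      proof
        assume "Domain (snd x) \<subseteq> Domain (snd y)"
        then show ?case using xy by (intro bexI[of _ y]) auto
      next
        assume "Domain (snd y) \<subseteq> Domain (snd x)"
        then show ?case using xy by (intro bexI[of _ x]) auto
      qed
    qed
    then obtain x where x: "x \<in> \<X>" "A \<subseteq> Domain (snd x)" by blast
    have "small (Domain (snd x))" using small_subset[OF sP DP[OF x(1)]] .
    then show ?thesis
      using indep_mono[OF R small_subset[OF sP RP] small_singleton[OF a(1)], of "Domain (snd x)" "{?a}" A]
        each[OF x(1)] x(2) by blast
  qed
  then have ind: "indep {?a} R ?P"
    using fin_witness[unfolded finite_witness_singletons_def, rule_format, of ?a "sub R" "sub ?P"]
      small_model_sub[OF R small_subset[OF sP RP]] small_model_sub[OF P sP] submodel_leK[OF R P RP] a(1)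
    by simp
  have real: "\<forall>p\<in>?D. fst p \<subseteq> ?P \<and> realizes K C ?a p"
  proof
    fix p assume "p \<in> ?D"
    then obtain x where x: "x \<in> \<X>" "p \<in> fst x" by blast
    then show "fst p \<subseteq> ?P \<and> realizes K C ?a p" using each[OF x(1)] DP[OF x(1)] by blast
  qed
  then have "consistent K C ?D" unfolding consistent_def using a(1) by blast
  \<comment> \<open>With all of \<open>?D\<close> realized by one element, the covering has at most
    \<chi> members, each of size at most \<chi>.\<close>
  then have "|?D| \<le>o \<chi>" using G_consistent DG by blast
  then have "|\<Union>p\<in>?D. Domain (snd (X p))| \<le>o \<chi>"
    using UNION_Cinfinite_bound[of ?D \<chi> "\<lambda>p. Domain (snd (X p))"] cardX \<chi>_Cinfinite by blast
  then have cP: "|?P| \<le>o \<chi>" using card_of_mono1[OF cover] ordLeq_transitive by blast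
  have RH: "\<forall>y\<in>R. (y, y) \<in> ?H" using partial_solutionD(6)[OF sol] ne by blast
  have "partial_solution R b (?D, ?H)"
    unfolding partial_solution_def fst_conv snd_conv
    using DG P cP RH g a ind real by blast
  moreover have "pair_le x (?D, ?H)" if "x \<in> \<X>" for x
    using bigger[OF that] that unfolding pair_le_def by auto
  ultimately show ?thesis by blast
qed

lemma partial_solution_maximal:
  assumes "submodel R" "|R| \<le>o \<mu>" "b \<in> univ C"
  shows "\<exists>m. partial_solution R b m \<and> (\<forall>x. partial_solution R b x \<and> pair_le m x \<longrightarrow> x = m)"
proof -
  let ?A = "{x. partial_solution R b x}"
  have "\<exists>m\<in>?A. \<forall>x\<in>?A. pair_le m x \<longrightarrow> x = m"
  proof (rule predicate_Zorn[OF partial_order_pair_le])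
    fix \<X> assume \<X>: "\<X> \<in> Chains (relation_of pair_le ?A)"
    show "\<exists>u\<in>?A. \<forall>a\<in>\<X>. pair_le a u"
    proof (cases "\<X> = {}")
      case True then show ?thesis using partial_solution_init[OF assms] by blast
    next
      case False
      have "partial_solution R b x" "pair_le x y \<or> pair_le y x" if "x \<in> \<X>" "y \<in> \<X>" for x y
        using \<X> that unfolding Chains_def relation_of_def by auto
      then show ?thesis using partial_solution_chain[OF assms(1) False] by blast
    qed
  qed
  then show ?thesis by blast
qed

section \<open>Enlarging a solution, and the bound on the family\<close>

text \<open>Let \<open>c\<close> be the realization belonging to \<open>m\<close>. The types of
  \<open>a\<close> over \<open>N \<union> R\<close> and of \<open>c\<close> over the model of
  \<open>m\<close> agree over \<open>R\<close> and do not fork over it, and their domains are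
  independent; so amalgamation yields one element \<open>d\<close> realizing both.\<close>

lemma partial_solution_extend:
  assumes m: "partial_solution R b m" and R: "submodel R" "|R| \<le>o \<mu>"
    and N: "N \<subseteq> univ C" "|N| \<le>o \<mu>" "indep (N \<union> R) R (Domain (snd m))"
    and a: "a \<in> univ C" "indep {a} R (N \<union> R)" "eqtp R a b" and p: "tp1 K C a N \<in> G" "tp1 K C a N \<notin> fst m"
  shows "\<exists>x. partial_solution R b x \<and> pair_le m x \<and> x \<noteq> m"
proof -
  let ?P = "Domain (snd m)" and ?p = "tp1 K C a N"
  note D = partial_solutionD[OF m]
  obtain g c where M: "aut g" "\<forall>(y, z)\<in>snd m. g y = z" "c \<in> univ C" "g c = b" "indep {c} R ?P"
    "\<forall>p\<in>fst m. fst p \<subseteq> ?P \<and> realizes K C c p"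
    using D(7) by blast
  have gR: "g y = y" if "y \<in> R" for y using D(6) M(2) that by fast
  have RC: "R \<subseteq> univ C" using submodel_subset R(1) by blast
  have cb: "eqtp R c b" unfolding eqtp_def using M(1,4) gR by blast
  \<comment> \<open>Both elements have the type of \<open>b\<close> over \<open>R\<close>, as
    \<open>g\<close> fixes \<open>R\<close> and sends \<open>c\<close> to \<open>b\<close>.\<close>
  have ac: "eqtp R a c" using eqtp_trans[OF a(3) eqtp_sym[OF cb RC M(3)]] .
  have "|N \<union> R \<union> ?P| \<le>o \<chi>"
    using Un_Cinfinite_bound N(2) R(2) D(3) \<mu>_le_\<chi> \<chi>_Cinfinite ordLeq_transitive by meson
  moreover have "N \<union> R \<union> ?P \<subseteq> univ C" using N(1) RC submodel_subset[OF D(2)] by blast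
  ultimately obtain Q where Q: "submodel Q" "N \<union> R \<union> ?P \<subseteq> Q" "|Q| \<le>o \<chi>"
    using hull_exists[OF LS(1) LS_le_\<chi> \<chi>_Cinfinite submodel_univ] by metis
  have sQ: "small Q" using small_if_le_\<chi> Q submodel_subset by blast
  obtain d where d: "d \<in> univ C" "eqtp (N \<union> R) d a" "eqtp ?P d c" "indep {d} R Q"
    using amalgamate_types[OF R(1) _ D(5) Q(1) sQ Q(2) N(3) a(1,2) M(3,5) ac] by blast
  obtain s where s: "aut s" "\<forall>y\<in>?P. s y = y" "s d = c" using d(3) unfolding eqtp_def by blast
  \<comment> \<open>\<open>s\<close> moves \<open>d\<close> back to \<open>c\<close> and fixes the
    old model. So the new map still extends the old graph and sends \<open>d\<close> to the
    unchanged \<open>b\<close>.\<close>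
  let ?g = "g \<circ> s"
  let ?H = "(\<lambda>y. (y, ?g y)) ` Q"
  have dom: "Domain ?H = Q" by force
  have mH: "snd m \<subseteq> ?H"
  proof clarify
    fix y z assume yz: "(y, z) \<in> snd m"
    then have "y \<in> ?P" by blast
    then have "s y = y" "y \<in> Q" using Q(2) s(2) by blast+
    moreover have "g y = z" using M(2) yz by fast
    ultimately have "y \<in> Q" "?g y = z" by simp_all
    then show "(y, z) \<in> ?H" by blast
  qed
  have PC: "?P \<subseteq> univ C" using submodel_subset D(2) by blast
  have "realizes K C d q" if "q \<in> fst m" for q
    using realizes_eqtp[OF _ eqtp_sym[OF d(3) PC d(1)] _ PC M(3)] M(6) that by blast
  moreover have "realizes K C d ?p"
  proof -
    have "eqtp N a d" using eqtp_mono[OF d(2)] eqtp_sym N(1) d(1) by blast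
    then show ?thesis unfolding realizes_def using tp1_eq_iff a(1) d(1) N(1) by auto
  qed
  ultimately have real: "\<forall>q\<in>insert ?p (fst m). fst q \<subseteq> Q \<and> realizes K C d q"
  proof (intro ballI conjI)
    fix q assume q: "q \<in> insert ?p (fst m)"
    then show "fst q \<subseteq> Q" using M(6) Q(2) by (cases "q = ?p") (simp, blast)
  qed blast
  have gd: "?g d = b" using s(3) M(4) by simp
  have gH: "\<forall>(y, z)\<in>?H. ?g y = z" by auto
  have RH: "\<forall>y\<in>R. (y, y) \<in> ?H" 
  proof
    fix y assume y: "y \<in> R"
    then have "y \<in> Q" "s y = y" using Q(2) s(2) D(5) by blast+
    then have "y \<in> Q" "?g y = y" using gR[OF y] by simp_all
    then show "(y, y) \<in> ?H" by force
  qed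
  have "partial_solution R b (insert ?p (fst m), ?H)"
    unfolding partial_solution_def fst_conv snd_conv dom
    using D(1) p(1) Q(1,3) RH gH is_iso_comp[OF s(1) M(1)] d(1,4) gd real by blast
  moreover have "pair_le m (insert ?p (fst m), ?H)" "(insert ?p (fst m), ?H) \<noteq> m"
    unfolding pair_le_def using mH p(2) by (auto simp: prod_eq_iff)
  ultimately show ?thesis by blast
qed

lemma card_of_G:
  assumes lc: "local_character_pair K kbar C ind kap ell"
    and kap: "kap \<le>o \<mu>" "cexp_less \<mu> ell =o \<mu>"
  shows "|G| \<le>o \<chi>"
proof (rule ccontr)
  assume big: "\<not> |G| \<le>o \<chi>"
  \<comment> \<open>The size of \<open>M\<^sub>0\<close> is inherited from the domain of any member
    of \<open>G\<close>.\<close>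
  then have "G \<noteq> {}" using card_of_empty3 by (metis card_of_empty1 card_order_on_well_order_on Card_order_cexp)
  then obtain N where "|N| \<le>o \<mu>" "M\<^sub>0 \<subseteq> N" using G_types by blast
  then have M\<^sub>0\<mu>: "|M\<^sub>0| \<le>o \<mu>" using card_of_mono1 ordLeq_transitive by blast
  let ?S = "\<lambda>R. {tp1 K C a R |a. a \<in> univ C}"
  \<comment> \<open>The realization and the maximal solution are chosen as functions of
    \<open>R\<close> and \<open>q\<close> alone, so each \<open>R\<close> contributes at most \<chi>
    of them.\<close>
  define rep where "rep R q = (SOME a. a \<in> univ C \<and> q = tp1 K C a R)" for R q
  have rep: "rep R q \<in> univ C \<and> q = tp1 K C (rep R q) R" if "q \<in> ?S R" for R q
    unfolding rep_def by (rule someI_ex) (use that in blast)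
  define m where "m R q = (SOME m. partial_solution R (rep R q) m \<and>
      (\<forall>x. partial_solution R (rep R q) x \<and> pair_le m x \<longrightarrow> x = m))" for R q
  have m: "partial_solution R (rep R q) (m R q) \<and>
      (\<forall>x. partial_solution R (rep R q) x \<and> pair_le (m R q) x \<longrightarrow> x = m R q)"
    if "submodel R" "|R| \<le>o \<mu>" "q \<in> ?S R" for R q
    unfolding m_def by (rule someI_ex[OF partial_solution_maximal[OF that(1,2) conjunct1[OF rep[OF that(3)]]]])
  \<comment> \<open>The closing function must be defined on all small sets; off the submodels it
    adds nothing.\<close>
  define F where "F R = (if submodel R then \<Union>q\<in>?S R. Domain (snd (m R q)) else {})" for R
  have tps: "|?S R| \<le>o \<chi>" if "submodel R" "|R| \<le>o \<mu>" for R
    using card_of_types[OF LS \<mu> that] .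
  have F: "F R \<subseteq> univ C \<and> |F R| \<le>o \<chi>" if "|R| \<le>o \<mu>" for R
  proof (cases "submodel R")
    case True
    have "submodel (Domain (snd (m R q))) \<and> |Domain (snd (m R q))| \<le>o \<chi>" if "q \<in> ?S R" for q
      using partial_solutionD(2,3) m[OF True \<open>|R| \<le>o \<mu>\<close> that] by blast
    then have sub: "Domain (snd (m R q)) \<subseteq> univ C" and card: "|Domain (snd (m R q))| \<le>o \<chi>" if "q \<in> ?S R" for q
      using that submodel_subset by simp_all
    have "(\<Union>q\<in>?S R. Domain (snd (m R q))) \<subseteq> univ C" by (rule UN_least) (rule sub)
    moreover have "|\<Union>q\<in>?S R. Domain (snd (m R q))| \<le>o \<chi>"
      by (rule UNION_Cinfinite_bound[OF tps[OF True \<open>|R| \<le>o \<mu>\<close>] _ \<chi>_Cinfinite]) (use card in blast)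
    ultimately show ?thesis unfolding F_def using True by simp
  next
    case False
    then show ?thesis unfolding F_def
      using Card_order_empty[OF Card_order_cexp] by auto
  qed
  have "\<exists>W\<in>Collect submodel. M\<^sub>0 \<subseteq> W \<and> |W| \<le>o \<chi> \<and> (\<forall>R. R \<subseteq> W \<and> R \<noteq> {} \<and> |R| \<le>o \<mu> \<longrightarrow> F R \<subseteq> W)"
  proof (rule closed_superset_exists[OF \<mu>(1), of "Collect submodel" "univ C" F "M\<^sub>0"])
    fix A assume "A \<subseteq> univ C" "|A| \<le>o \<chi>"
    then show "\<exists>B\<in>Collect submodel. A \<subseteq> B \<and> |B| \<le>o \<chi>"
      using hull_exists[OF LS(1) LS_le_\<chi> \<chi>_Cinfinite submodel_univ] by (metis mem_Collect_eq)
  next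
    fix \<C> :: "'a set set"
    assume "\<C> \<subseteq> Collect submodel" "\<C> \<noteq> {}" "\<And>A B. A \<in> \<C> \<Longrightarrow> B \<in> \<C> \<Longrightarrow> A \<subseteq> B \<or> B \<subseteq> A"
    then show "\<Union>\<C> \<in> Collect submodel" using submodel_Union_chain[of \<C>] by blast
  next
    show "|M\<^sub>0| \<le>o \<chi>" using M\<^sub>0\<mu> \<mu>_le_\<chi> ordLeq_transitive by blast
  qed (use F submodel_subset M\<^sub>0 in auto)
  then obtain W where W: "submodel W" "M\<^sub>0 \<subseteq> W" "|W| \<le>o \<chi>"
    and closed: "\<forall>R. R \<subseteq> W \<and> R \<noteq> {} \<and> |R| \<le>o \<mu> \<longrightarrow> F R \<subseteq> W" by blast
  have sW: "small W" using small_if_le_\<chi> W submodel_subset by blast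
  let ?I = "{R. R \<subseteq> W \<and> R \<noteq> {} \<and> |R| \<le>o \<mu>}"
  let ?J = "{R \<in> ?I. submodel R}"
  \<comment> \<open>At most \<chi> small models lie inside \<open>W\<close>, each with at most
    \<chi> types, and every maximal solution collects at most \<chi> members of \<open>G\<close>.
    Hence some \<open>p\<close> is collected by none of them.\<close>
  have "|?J| \<le>o \<chi>"
    using card_of_bounded_subsets[OF W(3) \<mu>(1)] card_of_mono1[of ?J ?I] ordLeq_transitive by blast
  moreover have "|\<Union>q\<in>?S R. fst (m R q)| \<le>o \<chi>" if "R \<in> ?J" for R
    using UNION_Cinfinite_bound[of "?S R" \<chi> "\<lambda>q. fst (m R q)"] tps that m partial_solution_consistent \<chi>_Cinfinite
    by blast
  ultimately have "|\<Union>R\<in>?J. \<Union>q\<in>?S R. fst (m R q)| \<le>o \<chi>"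
    using UNION_Cinfinite_bound[of ?J \<chi> "\<lambda>R. \<Union>q\<in>?S R. fst (m R q)"] \<chi>_Cinfinite by blast
  then have "\<not> G \<subseteq> (\<Union>R\<in>?J. \<Union>q\<in>?S R. fst (m R q))"
    using big card_of_mono1 ordLeq_transitive by blast
  then obtain p where p: "p \<in> G" and new: "p \<notin> (\<Union>R\<in>?J. \<Union>q\<in>?S R. fst (m R q))" by blast
  obtain a N where aN: "a \<in> univ C" "submodel N" "|N| \<le>o \<mu>" "M\<^sub>0 \<subseteq> N" "p = tp1 K C a N" "indep {a} M\<^sub>0 N"
    using G_types[OF p] by blast
  have NC: "N \<subseteq> univ C" using submodel_subset aN(2) by blast
  have sN: "small N" using small_if_le_\<mu> NC aN(3) by blast
  obtain R0 where R0: "R0 \<subseteq> W" "submodel R0" "|R0| \<le>o \<mu>" "indep N R0 W"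
    using local_character_set[OF lc \<mu>(1) kap sN aN(3) W(1) sW] by blast
  \<comment> \<open>The base has to contain \<open>R0\<close>, for the independence of
    \<open>N\<close> from \<open>W\<close>, and \<open>M\<^sub>0\<close>, for the nonforking of
    \<open>p\<close>. Taking the hull inside \<open>W\<close> makes the closure of \<open>W\<close>
    applicable to it.\<close>
  have "|R0 \<union> M\<^sub>0| \<le>o \<mu>" using Un_Cinfinite_bound R0(3) M\<^sub>0\<mu> \<mu>(1) by blast
  moreover have "R0 \<union> M\<^sub>0 \<subseteq> W" using R0(1) W(2) by blast
  ultimately obtain R where R: "submodel R" "R0 \<union> M\<^sub>0 \<subseteq> R" "R \<subseteq> W" "|R| \<le>o \<mu>"
    using hull_exists[OF LS \<mu>(1) W(1)] by metis
  have R0R: "R0 \<subseteq> R" and M\<^sub>0R: "M\<^sub>0 \<subseteq> R" using R(2) by blast+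
  have sR: "small R" using small_subset[OF sW R(3)] .
  have RJ: "R \<in> ?J" using R submodel_nonempty by blast
  have "indep N R W" using indep_base_mono[OF R0(2) R(1) sW sN R0(4) R0R R(3)] .
  then have "indep (N \<union> R) R (W \<union> R)" using indep_normal[OF R(1) sR sN sW] by blast
  moreover have "W \<union> R = W" using R(3) by blast
  ultimately have NW: "indep (N \<union> R) R W" by simp
  \<comment> \<open>Independence of \<open>a\<close> is known over \<open>N\<close> only, while
    amalgamation needs it over \<open>N\<close> and \<open>R\<close> together. So \<open>a\<close>
    is replaced by a realization \<open>c\<close> of \<open>p\<close> that is independent from a
    model containing both; transitivity gives this over \<open>M\<^sub>0\<close>, and base
    monotonicity over \<open>R\<close>.\<close>
  have "|N \<union> R| \<le>o \<mu>" using Un_Cinfinite_bound aN(3) R(4) \<mu>(1) by blast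
  moreover have "N \<union> R \<subseteq> univ C" using NC R(1) submodel_subset by blast
  ultimately obtain N1 where N1: "submodel N1" "N \<union> R \<subseteq> N1" "|N1| \<le>o \<mu>"
    using hull_exists[OF LS \<mu>(1) submodel_univ] by metis
  have sN1: "small N1" using small_if_le_\<mu> N1 submodel_subset by blast
  have NN1: "N \<subseteq> N1" and RN1: "R \<subseteq> N1" using N1(2) by blast+
  obtain c where c: "c \<in> univ C" "eqtp N c a" "indep {c} N N1"
    using nonforking_extension[OF aN(1,2) N1(1) sN1 NN1] by blast
  have ac: "eqtp N a c" using eqtp_sym[OF c(2) NC c(1)] .
  have "indep {c} M\<^sub>0 N" using indep_eqtp[OF M\<^sub>0 aN(4) sN aN(1) aN(6) ac] .
  then have "indep {c} M\<^sub>0 N1"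
    using indep_trans[OF M\<^sub>0 aN(2) sN small_singleton[OF c(1)] sN1 aN(4) _ c(3)] by blast
  then have "indep {c} R N1"
    using indep_base_mono[OF M\<^sub>0 R(1) sN1 small_singleton[OF c(1)] _ M\<^sub>0R RN1] by blast
  then have cR: "indep {c} R (N \<union> R)"
    using indep_mono[OF R(1) sR small_singleton[OF c(1)] sN1 _ subset_refl N1(2)] by blast
  have pc: "p = tp1 K C c N" using aN(5) tp1_eq_iff[OF aN(1) c(1) NC] ac by blast
  let ?q = "tp1 K C c R"
  have q: "?q \<in> ?S R" using c(1) by blast
  have "eqtp R c (rep R ?q)" using rep[OF q] tp1_eq_iff[OF c(1)] submodel_subset[OF R(1)] by blast
  moreover have "Domain (snd (m R ?q)) \<subseteq> F R" unfolding F_def using R(1) q by auto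
  then have PW: "Domain (snd (m R ?q)) \<subseteq> W" using closed RJ by blast
  \<comment> \<open>The maximal solution for \<open>R\<close> and \<open>?q\<close> lives inside
    \<open>W\<close>, so independence from \<open>W\<close> passes to it.\<close>
  have "indep (N \<union> R) R (Domain (snd (m R ?q)))"
    using indep_mono[OF R(1) sR small_Un[OF sN sR] sW NW subset_refl PW] .
  moreover have "tp1 K C c N \<notin> fst (m R ?q)" using new RJ q unfolding pc by blast
  ultimately obtain x where "partial_solution R (rep R ?q) x" "pair_le (m R ?q) x" "x \<noteq> m R ?q"
    using partial_solution_extend[OF conjunct1[OF m[OF R(1,4) q]] R(1,4) NC aN(3) _ c(1) cR] p
    unfolding pc by blast
  then show False using m[OF R(1,4) q] by blast
qed

end

section \<open>From a family with a common base to the bound\<close>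

text \<open>As \<open>kap\<close> is nonzero, \<open>kap +c cone\<close> is at most twice
  \<open>kap\<close>, and the factor 2 in the exponent is absorbed since the infinite
  \<open>lam\<close> equals its square. Finite and infinite \<open>kap\<close> are covered at
  once.\<close>

lemma cexp_csum_cone:
  assumes lam: "Cinfinite lam" and kap: "Card_order kap" "Field kap \<noteq> {}"
  shows "lam ^c (kap +c cone) \<le>o lam ^c kap"
proof -
  have "cone \<le>o kap" using cone_ordLeq_Cnotzero kap czeroE by blast
  then have "kap +c cone \<le>o kap +c kap" by (rule csum_mono2)
  also have "kap +c kap =o |Field kap \<times> (UNIV :: bool set)|"
    unfolding csum_def by (rule card_of_Plus_Times_bool)
  also have "|Field kap \<times> (UNIV :: bool set)| =o ctwo *c kap"
    unfolding cprod_def ctwo_def Field_card_of by (rule card_of_Times_commute)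
  finally have "lam ^c (kap +c cone) \<le>o lam ^c (ctwo *c kap)"
    by (rule cexp_mono2') (use lam kap(2) in \<open>auto simp: Field_csum\<close>)
  also have "lam ^c (ctwo *c kap) =o (lam ^c ctwo) ^c kap"
    using cexp_cprod lam ordIso_symmetric by blast
  also have "(lam ^c ctwo) ^c kap \<le>o lam ^c kap"
  proof (rule cexp_mono1[OF _ kap(1)])
    have "|Func (UNIV :: bool set) (Field lam)| \<le>o |Field lam \<times> Field lam|"
      by (rule card_of_ordLeqI[of "\<lambda>f. (f True, f False)"])
        (auto simp: inj_on_def Func_def fun_eq_iff, metis (full_types))
    also have "|Field lam \<times> Field lam| =o lam"
      using cprod_infinite[OF lam] unfolding cprod_def .
    finally show "lam ^c ctwo \<le>o lam" by (simp add: cexp_def ctwo_def Field_card_of)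
  qed
  finally show ?thesis .
qed

text \<open>The successor is at most the power of 2. Since \<open>strong_limit\<close> speaks of
  cardinals on the type of \<open>k\<close>, \<open>r\<close> is first copied to a subset
  \<open>B\<close> of \<open>Field k\<close>.\<close>

lemma strong_limit_cardSuc:
  assumes k: "strong_limit k" and r: "Card_order r" "r <o k"
  shows "cardSuc r <o k"
proof -
  have "|Field r| <o k" using card_of_Field_ordIso[OF r(1)] r(2) ordIso_ordLess_trans by blast
  from internalize_card_of_ordLess[THEN iffD1, OF this]
  obtain B where "B \<subset> Field k" and B: "|Field r| =o |B|" "|B| <o k" by blast
  have rB: "r =o |B|" using card_of_Field_ordIso[OF r(1)] B(1) ordIso_symmetric ordIso_transitive by blast
  have "|B| <o ctwo ^c |B|" using ordLess_ctwo_cexp card_of_Card_order by blast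
  then have "r <o ctwo ^c |B|" using rB ordIso_ordLess_trans by blast
  then have "cardSuc r \<le>o ctwo ^c |B|" using cardSuc_least r(1) Card_order_cexp by blast
  moreover have "ctwo ^c |B| <o k" using k B(2) card_of_Card_order unfolding strong_limit_def by blast
  ultimately show ?thesis using ordLeq_ordLess_trans by blast
qed

lemma subset_of_card_cardSuc:
  assumes r: "Card_order r" and S: "\<not> |S| \<le>o r"
  shows "\<exists>T\<subseteq>S. |T| =o cardSuc r"
proof -
  have suc: "Card_order (cardSuc r)" using cardSuc_Card_order[OF r] .
  have "r <o |S|" using not_ordLeq_iff[OF card_of_Card_order r] S by blast
  then have "cardSuc r \<le>o |S|" using cardSuc_least[OF r card_of_Card_order] by blast
  then have "|Field (cardSuc r)| \<le>o |S|"
    using card_of_Field_ordIso[OF suc] ordIso_ordLeq_trans by blast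
  then obtain f where f: "inj_on f (Field (cardSuc r))" "f ` Field (cardSuc r) \<subseteq> S"
    using card_of_ordLeq[of "Field (cardSuc r)" S] by blast
  have "|Field (cardSuc r)| =o |f ` Field (cardSuc r)|"
    using card_of_ordIsoI[OF inj_on_imp_bij_betw[OF f(1)]] .
  then have "|f ` Field (cardSuc r)| =o cardSuc r"
    using card_of_Field_ordIso[OF suc] ordIso_symmetric ordIso_transitive by blast
  then show ?thesis using f(2) by blast
qed

theorem theorem6p2:
  fixes K :: "('f, 'r, 'a) aec"
    and C :: "('f, 'r, 'a) struct"
    and ind :: "('f, 'r, 'a) indrel"
    and kbar LS \<mu> lam kap ell :: "'a rel"
  assumes "AEC K" and "joint_embedding K" and "amalgamation K" and "no_maximal_models K"
    and "monster K kbar C"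
    and "simple_independence_relation K kbar C ind"
    and "finite_witness_singletons K kbar C ind"
    and "is_LS K LS"
    and "is_kappa_ell K kbar C ind kap ell"
    and "Card_order \<mu>" and "Card_order lam" and "lam <o kbar"
    and "LS \<le>o \<mu>" and "\<mu> \<le>o lam"
    and "kap \<le>o \<mu>" and "cexp_less \<mu> ell =o \<mu>"
  shows "NT K C \<mu> lam (cardSuc (ctwo ^c \<mu>)) \<le>o (lam ^c kap) +c (ctwo ^c \<mu>)"
proof -
  interpret simple_independence K kbar C ind
    using assms by unfold_locales
  let ?\<chi> = "ctwo ^c \<mu>" and ?\<rho> = "(lam ^c kap) +c (ctwo ^c \<mu>)"
  have LS: "LST_bound K LS" using assms(8) unfolding is_LS_def by blast
  have lc: "local_character_pair K kbar C ind kap ell" and kap: "Card_order kap" "Field kap \<noteq> {}"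
    using assms(9) unfolding is_kappa_ell_def local_character_pair_def by auto
  have "cinfinite LS" using LS unfolding LST_bound_def by blast
  then have \<mu>: "Cinfinite \<mu>" using cinfinite_mono[OF assms(13)] assms(10) by blast
  then have lam: "Cinfinite lam" using cinfinite_mono[OF assms(14)] assms(11) by blast
  have \<mu>k: "\<mu> <o kbar" using assms(12,14) ordLeq_ordLess_trans by blast
  have \<chi>: "Card_order ?\<chi>" "Cinfinite ?\<chi>" "?\<chi> \<le>o ?\<rho>"
    using Card_order_cexp Cinfinite_cexp[OF ordLeq_refl[OF Card_order_ctwo] \<mu>] ordLeq_csum2 by blast+
  have \<rho>: "Cinfinite ?\<rho>" using Cinfinite_csum \<chi>(2) by blast
  have sl: "strong_limit kbar" using mon unfolding monster_def by blast
  then have "?\<chi> <o kbar" using \<mu>k assms(10) unfolding strong_limit_def by blast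
  then have suck: "cardSuc ?\<chi> <o kbar" using strong_limit_cardSuc[OF sl \<chi>(1)] by blast
  have main: "|\<Gamma>| \<le>o ?\<rho>"
    if M: "leK K M C" "|univ M| =o lam" and \<Gamma>: "\<Gamma> \<subseteq> S_le K C M \<mu>"
      and incons: "\<forall>\<Delta>\<subseteq>\<Gamma>. cardSuc ?\<chi> \<le>o |\<Delta>| \<longrightarrow> \<not> consistent K C \<Delta>" for M \<Gamma>
  proof (rule ccontr)
    assume big: "\<not> |\<Gamma>| \<le>o ?\<rho>"
    \<comment> \<open>By local character every type in \<open>\<Gamma>\<close> has such a base. Its
      size bound \<open>kap +c cone\<close> and its position inside \<open>M\<close> limit the
      number of bases to \<open>lam ^c kap\<close>.\<close>
    define base where "base p B \<longleftrightarrow> submodel B \<and> |B| \<le>o kap +c cone \<and> B \<subseteq> univ M \<and>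
      (\<exists>a N. a \<in> univ C \<and> submodel N \<and> |N| \<le>o \<mu> \<and> B \<subseteq> N \<and> p = tp1 K C a N \<and> indep {a} B N)" for p B
    have "\<exists>B. base p B" if p: "p \<in> \<Gamma>" for p
    proof -
      obtain a N where N: "a \<in> univ C" "leK K N M" "|univ N| \<le>o \<mu>" "p = tp1 K C a (univ N)"
        using p \<Gamma> unfolding S_le_def by blast
      have sN: "submodel (univ N)" using leK_trans[OF N(2) M(1)] leK_submodel by blast
      have "small (univ N)"
        using submodel_subset[OF sN] N(3) \<mu>k ordLeq_ordLess_trans unfolding small_set_def by blast
      then obtain B where B: "B \<subseteq> univ N" "submodel B" "|B| \<le>o kap +c cone" "indep {a} B (univ N)"
        using local_character_element[OF lc N(1) sN] by blast
      have "univ N \<subseteq> univ M" using leK_substruct[OF N(2)] unfolding substruct_def by blast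
      then show ?thesis unfolding base_def using B N sN by blast
    qed
    then have base: "base p (SOME B. base p B)" if "p \<in> \<Gamma>" for p
      by (rule someI_ex[OF _]) (rule that)
    let ?f = "\<lambda>p. SOME B. base p B"
    let ?I = "{B. B \<subseteq> univ M \<and> B \<noteq> {} \<and> |B| \<le>o kap +c cone}"
    have "?f ` \<Gamma> \<subseteq> ?I"
    proof
      fix B assume "B \<in> ?f ` \<Gamma>"
      then obtain p where "base p B" using base by blast
      then show "B \<in> ?I" using submodel_nonempty unfolding base_def by blast
    qed
    then have "|?f ` \<Gamma>| \<le>o |?I|" by (rule card_of_mono1)
    also have "|?I| \<le>o |univ M| ^c (kap +c cone)"
      by (rule card_of_subsets_ordLeq_cexp[OF Card_order_csum])
    also have "|univ M| ^c (kap +c cone) \<le>o lam ^c (kap +c cone)"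
      using cexp_mono1 M(2) Card_order_csum ordIso_iff_ordLeq by blast
    also have "lam ^c (kap +c cone) \<le>o lam ^c kap" by (rule cexp_csum_cone[OF lam kap])
    also have "lam ^c kap \<le>o ?\<rho>" by (rule ordLeq_csum1[OF Card_order_cexp])
    finally have "|?f ` \<Gamma>| \<le>o ?\<rho>" .
    from card_of_fibre[OF \<rho> this big \<chi>(3)]
    obtain B where B: "B \<in> ?f ` \<Gamma>" "\<not> |{p \<in> \<Gamma>. ?f p = B}| \<le>o ?\<chi>" by blast
    \<comment> \<open>Exactly the successor of \<open>?\<chi>\<close> many types are kept: enough
      for the contradiction, and below the strong limit \<open>kbar\<close>.\<close>
    obtain G where G: "G \<subseteq> {p \<in> \<Gamma>. ?f p = B}" "|G| =o cardSuc ?\<chi>"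
      using subset_of_card_cardSuc[OF \<chi>(1) B(2)] by blast
    have baseB: "base p B" if "p \<in> G" for p using base[of p] G(1) that by blast
    have "submodel B" using B(1) base unfolding base_def by blast
    moreover have "\<exists>a N. a \<in> univ C \<and> submodel N \<and> |N| \<le>o \<mu> \<and> B \<subseteq> N \<and> p = tp1 K C a N \<and> indep {a} B N"
      if "p \<in> G" for p
      using baseB[OF that] unfolding base_def by blast
    moreover have "|G| <o kbar" using G(2) suck ordIso_ordLess_trans by blast
    moreover have "|\<Delta>| \<le>o ?\<chi>" if "\<Delta> \<subseteq> G" "consistent K C \<Delta>" for \<Delta>
    proof -
      have "\<Delta> \<subseteq> \<Gamma>" using that(1) G(1) by blast
      then have "\<not> cardSuc ?\<chi> \<le>o |\<Delta>|" using incons that(2) by blast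
      then have "|\<Delta>| <o cardSuc ?\<chi>"
        using not_ordLeq_iff[OF cardSuc_Card_order[OF \<chi>(1)] card_of_Card_order] by blast
      then show ?thesis using cardSuc_ordLess_ordLeq[OF card_of_Card_order \<chi>(1)] cardSuc_ordLeq_ordLess[OF \<chi>(1) card_of_Card_order] by blast
    qed
    ultimately interpret type_family K kbar C ind \<mu> LS B G
      using LS assms(13) \<mu> \<mu>k by unfold_locales auto
    have "|G| \<le>o ?\<chi>" using card_of_G[OF lc assms(15,16)] .
    then have "cardSuc ?\<chi> \<le>o ?\<chi>" using G(2) ordIso_symmetric ordIso_ordLeq_trans by blast
    then show False using cardSuc_greater[OF \<chi>(1)] not_ordLess_ordLeq by blast
  qed
  show ?thesis unfolding NT_def
  proof (rule card_sup_ordLeq)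
    fix r assume "r \<in> {|\<Gamma>| |\<Gamma>. \<exists>M. leK K M C \<and> |univ M| =o lam \<and> \<Gamma> \<subseteq> S_le K C M \<mu> \<and>
      (\<forall>\<Delta>\<subseteq>\<Gamma>. cardSuc ?\<chi> \<le>o |\<Delta>| \<longrightarrow> \<not> consistent K C \<Delta>)}"
    then obtain \<Gamma> M where "r = |\<Gamma>|" "leK K M C" "|univ M| =o lam" "\<Gamma> \<subseteq> S_le K C M \<mu>"
      "\<forall>\<Delta>\<subseteq>\<Gamma>. cardSuc ?\<chi> \<le>o |\<Delta>| \<longrightarrow> \<not> consistent K C \<Delta>" by blast
    then show "r \<le>o ?\<rho>" using main by blast
  qed (auto simp: card_of_Card_order Card_order_csum)
qed

end
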